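(* Let $0\le\beta<1$, and set $\widetilde L:=[e|\log p|]$, $\widetilde M:=[eNp|\log p|]$. Let $P^{\mathcal P-\mathcal P}_{N,\widetilde M,\widetilde L}$ be the distribution on $N\times\widetilde M$ binary matrices $C_{N,\widetilde M}=(c_{i,a})$ under which the entries $c_{i,a}$ are independent Bernoulli random variables with $\Pr(c_{i,a}=1)=\widetilde L/\widetilde M$, i.e. $P^{\mathcal P-\mathcal P}_{N,\widetilde M,\widetilde L}(C)=\prod_{a=1}^{\widetilde M}\prod_{i=1}^N(\widetilde L/\widetilde M)^{c_{i,a}}(1-\widetilde L/\widetilde M)^{1-c_{i,a}}$. Then $$\lim_{N\to\infty\vert\beta}\sum_{C_{N,\widetilde M}}P^{\mathcal P-\mathcal P}_{N,\widetilde M,\widetilde L}(C_{N,\widetilde M})\,\frac{T_{\widetilde M,C_{N,\widetilde M},p}}{Np|\log p|}=e.$$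
   Context: Probabilistic group testing with two-stage algorithms. For an integer $N\ge1$ and $p\in(0,1)$, a configuration $X=(x_1,\dots,x_N)\in\{0,1\}^N$ is drawn from $\mu_p(X)=\prod_{i} p^{x_i}(1-p)^{1-x_i}$. A first stage with $M$ tests is an $N\times M$ binary matrix $C_{N,M}=(c_{i,a})$; variable $i$ belongs to test $a$ iff $c_{i,a}=1$. Test outcome $T_a=0$ if $c_{i,a}x_i=0$ for all $i$, else $T_a=1$. Variable $i$ is a sure zero if some $a$ has $c_{i,a}=1$ and $T_a=0$; it is a sure one if $x_i=1$ and some $a$ with $c_{i,a}=1$ has every other $j$ with $c_{j,a}=1$ a sure zero. $\mathcal U_0$ is the set of $i$ with $x_i=0$ not sure zeros, $\mathcal U_1$ the set of $i$ with $x_i=1$ not sure ones. $T_{M,C_{N,M},p}:=M+\sum_X\mu_p(X)(|\mathcal U_0|+|\mathcal U_1|)$. $[x]$ denotes the integer part, $\log$ the natural logarithm. For $\beta>0$, $\lim_{N\to\infty\vert\beta}f(N,p):=\lim_{N\to\infty}f(N,N^{-\beta})$; for $\beta=0$, $\lim_{N\to\infty\vert 0}f(N,p):=\lim_{p\to0}\lim_{N\to\infty}f(N,p)$. *)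

theory Defs
  imports "HOL-Analysis.Analysis"
begin

text \<open>Variables are indexed by 0..<N, tests by 0..<M.
  A configuration X is represented by the set of indices i with x_i = 1 (a subset of {0..<N}).
  A first-stage matrix C is represented by the set of pairs (i,a) with c_{i,a} = 1
  (a subset of {0..<N} \<times> {0..<M}).\<close>

definition mu :: "nat \<Rightarrow> real \<Rightarrow> nat set \<Rightarrow> real" where
  "mu N p X = (\<Prod>i\<in>{0..<N}. if i \<in> X then p else 1 - p)"

definition test_out :: "(nat \<times> nat) set \<Rightarrow> nat set \<Rightarrow> nat \<Rightarrow> bool" where
  "test_out C X a = (\<exists>i\<in>X. (i, a) \<in> C)"

definition sure_zero :: "nat \<Rightarrow> (nat \<times> nat) set \<Rightarrow> nat set \<Rightarrow> nat \<Rightarrow> bool" where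
  "sure_zero M C X i = (\<exists>a<M. (i, a) \<in> C \<and> \<not> test_out C X a)"

definition sure_one :: "nat \<Rightarrow> nat \<Rightarrow> (nat \<times> nat) set \<Rightarrow> nat set \<Rightarrow> nat \<Rightarrow> bool" where
  "sure_one N M C X i = (i \<in> X \<and> (\<exists>a<M. (i, a) \<in> C \<and>
      (\<forall>j<N. j \<noteq> i \<and> (j, a) \<in> C \<longrightarrow> sure_zero M C X j)))"

definition U0 :: "nat \<Rightarrow> nat \<Rightarrow> (nat \<times> nat) set \<Rightarrow> nat set \<Rightarrow> nat set" where
  "U0 N M C X = {i. i < N \<and> i \<notin> X \<and> \<not> sure_zero M C X i}"

definition U1 :: "nat \<Rightarrow> nat \<Rightarrow> (nat \<times> nat) set \<Rightarrow> nat set \<Rightarrow> nat set" where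
  "U1 N M C X = {i. i < N \<and> i \<in> X \<and> \<not> sure_one N M C X i}"

text \<open>T_{M,C,p}: number of first-stage tests plus expected number of second-stage tests.\<close>
definition Tcost :: "nat \<Rightarrow> nat \<Rightarrow> (nat \<times> nat) set \<Rightarrow> real \<Rightarrow> real" where
  "Tcost N M C p = real M +
     (\<Sum>X\<in>Pow {0..<N}. mu N p X * real (card (U0 N M C X) + card (U1 N M C X)))"

definition Ltil :: "real \<Rightarrow> nat" where
  "Ltil p = nat \<lfloor>exp 1 * \<bar>ln p\<bar>\<rfloor>"

definition Mtil :: "nat \<Rightarrow> real \<Rightarrow> nat" where
  "Mtil N p = nat \<lfloor>exp 1 * real N * p * \<bar>ln p\<bar>\<rfloor>"

definition PP :: "nat \<Rightarrow> nat \<Rightarrow> nat \<Rightarrow> (nat \<times> nat) set \<Rightarrow> real" where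
  "PP N M L C = (\<Prod>a\<in>{0..<M}. \<Prod>i\<in>{0..<N}.
      if (i, a) \<in> C then real L / real M else 1 - real L / real M)"

definition avg_cost :: "nat \<Rightarrow> real \<Rightarrow> real" where
  "avg_cost N p = (\<Sum>C\<in>Pow ({0..<N} \<times> {0..<Mtil N p}).
      PP N (Mtil N p) (Ltil p) C * (Tcost N (Mtil N p) C p / (real N * p * \<bar>ln p\<bar>)))"

end

theory Submission
  imports Defs "HOL-Real_Asymp.Real_Asymp"
begin

text \<open>
  Given a configuration with \<open>k\<close> ones, the columns of the random matrix are independent, so with
  \<open>q = L / M\<close> a zero stays undetermined with probability exactly \<open>(1 - q (1 - q) ^ k) ^ M\<close>, and the
  probability that a one stays undetermined is an explicit nested binomial average.  Since
  \<open>k\<close> is about \<open>N p\<close>, the former is of order \<open>exp (- L / e)\<close>, that is \<open>O(p)\<close>, and the latter is at most 1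
  for each of the \<open>N p\<close> ones; divided by \<open>N p |ln p|\<close> both contributions are \<open>O(1 / |ln p|)\<close>, and only
  the first-stage cost \<open>M / (N p |ln p|)\<close>, which tends to \<open>e\<close>, survives.  For \<open>\<beta> > 0\<close> a Chernoff bound
  controls atypically large \<open>k\<close>.  For \<open>\<beta> = 0\<close> the inner limit has to exist for fixed \<open>p\<close>; there all nested
  binomial variables concentrate, except one whose average is a known generating function.
\<close>

section \<open>Averages over random subsets\<close>

text \<open>The factor e comes from maximising \<open>q * (1 - q) ^ k\<close> over \<open>q\<close>:
  the best \<open>q\<close> is about 1 / k, which for k near N p is L / M, and the maximum is about
  q / e. With L = e |log p| a zero then survives with probability about exp (- L / e) = p, so about
  N p zeros remain, as many as there are ones. The integer part in L costs at most a constant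
  factor, which the division by |log p| absorbs.

  For \<beta> > 0 two demands on the window for k compete. Survival of a zero increases with k, so
  only the upper side matters; at k = (1 + \<delta>) N p its probability grows to about p exp
  (\<delta> |log p|), which forces \<delta> = O(1 / |log p|), while the tail beyond the window has
  to be o(p |log p|).

  For \<beta> = 0 the expected number of variables in a test stays bounded as N grows with p fixed.
  A one is therefore missed with a probability whose limit need not be 0 or 1; it has to be shown to
  exist, but afterwards it only enters through its bounds 0 and 1.\<close>

definition bernoulli_avg :: "'a set \<Rightarrow> real \<Rightarrow> ('a set \<Rightarrow> real) \<Rightarrow> real" where
  "bernoulli_avg A q f = (\<Sum>C\<in>Pow A. (\<Prod>x\<in>A. if x \<in> C then q else 1 - q) * f C)"

lemma bernoulli_avg_empty [simp]: "bernoulli_avg {} q f = f {}"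
  by (simp add: bernoulli_avg_def)

lemma bernoulli_avg_cong:
  assumes "\<And>C. C \<subseteq> A \<Longrightarrow> f C = g C"
  shows "bernoulli_avg A q f = bernoulli_avg A q g"
  unfolding bernoulli_avg_def by (rule sum.cong) (auto simp: assms)

text \<open>Conditioning on a single element is the induction step behind most identities of this
  section. They are polynomial in \<open>q\<close> and hold for every real \<open>q\<close>; this
  matters because \<open>Ltil p\<close> divided by \<open>Mtil N p\<close> can exceed 1 for small
  \<open>N\<close>.\<close>

lemma bernoulli_avg_insert:
  assumes "finite A" "x \<notin> A"
  shows "bernoulli_avg (insert x A) q f =
    q * bernoulli_avg A q (\<lambda>C. f (insert x C)) + (1 - q) * bernoulli_avg A q f"
proof -
  have inj: "inj_on (insert x) (Pow A)"
    using assms(2) by (auto simp: inj_on_def)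
  have disj: "Pow A \<inter> insert x ` Pow A = {}"
    using assms(2) by auto
  have w: "(\<Prod>y\<in>A. if y \<in> insert x C then q else 1 - q) = (\<Prod>y\<in>A. if y \<in> C then q else 1 - q)" for C
    using assms(2) by (intro prod.cong) auto
  have nx: "x \<notin> C" if "C \<in> Pow A" for C
    using that assms(2) by auto
  show ?thesis
    unfolding bernoulli_avg_def Pow_insert
    using assms
    by (simp add: sum.union_disjoint disj sum.reindex[OF inj] w sum_distrib_left mult.assoc
        del: insert_iff) (auto intro!: sum.cong dest: nx)
qed

lemma bernoulli_avg_Un:
  assumes "finite A" "finite B" "A \<inter> B = {}"
  shows "bernoulli_avg (A \<union> B) q f = bernoulli_avg A q (\<lambda>C. bernoulli_avg B q (\<lambda>D. f (C \<union> D)))"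
  using assms
proof (induction A arbitrary: f rule: finite_induct)
  case (insert x A)
  then show ?case
    by (simp add: bernoulli_avg_insert)
qed auto

lemma bernoulli_avg_const [simp]: "finite A \<Longrightarrow> bernoulli_avg A q (\<lambda>C. c) = c"
  by (induction A rule: finite_induct) (auto simp: bernoulli_avg_insert algebra_simps)

lemma bernoulli_avg_sum: "bernoulli_avg A q (\<lambda>C. \<Sum>i\<in>I. f i C) = (\<Sum>i\<in>I. bernoulli_avg A q (f i))"
  unfolding bernoulli_avg_def sum_distrib_left by (rule sum.swap)

lemma bernoulli_avg_add:
  "bernoulli_avg A q (\<lambda>C. f C + g C) = bernoulli_avg A q f + bernoulli_avg A q g"
  unfolding bernoulli_avg_def by (simp add: algebra_simps sum.distrib)

lemma bernoulli_avg_divide: "bernoulli_avg A q (\<lambda>C. f C / c) = bernoulli_avg A q f / c"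
  unfolding bernoulli_avg_def by (simp add: sum_divide_distrib)

lemma bernoulli_avg_swap:
  "bernoulli_avg A q (\<lambda>C. bernoulli_avg B r (\<lambda>D. f C D)) =
   bernoulli_avg B r (\<lambda>D. bernoulli_avg A q (\<lambda>C. f C D))"
  unfolding bernoulli_avg_def sum_distrib_left
  by (subst sum.swap) (simp add: mult_ac)

lemma bernoulli_avg_power:
  "finite A \<Longrightarrow> bernoulli_avg A q (\<lambda>C. y ^ card C) = (1 - q + q * y) ^ card A"
proof (induction A rule: finite_induct)
  case (insert x A)
  have "bernoulli_avg A q (\<lambda>C. y ^ card (insert x C)) = bernoulli_avg A q (\<lambda>C. y * y ^ card C)"
    using insert.hyps by (intro bernoulli_avg_cong) (metis card_insert_disjoint finite_subset power_Suc subsetD)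
  also have "\<dots> = y * bernoulli_avg A q (\<lambda>C. y ^ card C)"
    by (simp add: bernoulli_avg_def sum_distrib_left mult_ac)
  finally show ?case
    using insert by (simp add: bernoulli_avg_insert algebra_simps)
qed auto

lemma bernoulli_avg_marginal:
  assumes "finite A" "B \<subseteq> A"
  shows "bernoulli_avg A q (\<lambda>C. f (C \<inter> B)) = bernoulli_avg B q f"
proof -
  have fin: "finite B" "finite (A - B)" using assms finite_subset by auto
  have "bernoulli_avg A q (\<lambda>C. f (C \<inter> B)) = bernoulli_avg (B \<union> (A - B)) q (\<lambda>C. f (C \<inter> B))"
    using assms by (simp add: Un_absorb1)
  also have "\<dots> = bernoulli_avg B q (\<lambda>C. bernoulli_avg (A - B) q (\<lambda>D. f ((C \<union> D) \<inter> B)))"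
    using fin by (subst bernoulli_avg_Un) auto
  also have "\<dots> = bernoulli_avg B q (\<lambda>C. bernoulli_avg (A - B) q (\<lambda>D. f C))"
    by (intro bernoulli_avg_cong arg_cong[where f = f]) auto
  finally show ?thesis using fin by simp
qed

lemma bernoulli_avg_if_empty:
  "finite A \<Longrightarrow> bernoulli_avg A q (\<lambda>C. if C = {} then u else v) =
    (1 - q) ^ card A * u + (1 - (1 - q) ^ card A) * v"
proof (induction A rule: finite_induct)
  case (insert x A)
  then show ?case by (simp add: bernoulli_avg_insert) (simp add: algebra_simps)
qed auto

lemma bernoulli_avg_disjoint:
  assumes "finite A" "B \<subseteq> A"
  shows "bernoulli_avg A q (\<lambda>C. of_bool (C \<inter> B = {})) = (1 - q) ^ card B"
  using bernoulli_avg_marginal[OF assms, of q "\<lambda>C. of_bool (C = {})"]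
    bernoulli_avg_if_empty[of B q 1 0] finite_subset[OF assms(2,1)]
  by (simp add: of_bool_def)

lemma bernoulli_avg_image:
  assumes "finite A" "inj_on h A"
  shows "bernoulli_avg (h ` A) q f = bernoulli_avg A q (\<lambda>C. f (h ` C))"
  using assms
proof (induction A arbitrary: f rule: finite_induct)
  case (insert x A)
  then show ?case by (simp add: bernoulli_avg_insert)
qed auto

text \<open>The fibres of \<open>h\<close> are disjoint blocks of \<open>m\<close> elements, each
  missed by the random set independently with probability \<open>(1 - q) ^ m\<close>, so the set of
  missed fibres is again a Bernoulli set. With \<open>h = snd\<close> it describes the tests avoided
  by a set of variables, with \<open>h = fst\<close> the variables avoiding a set of tests.\<close>

lemma bernoulli_avg_empty_fibres:
  assumes "finite B" "finite A" "h ` A \<subseteq> B" "\<And>b. b \<in> B \<Longrightarrow> card {x\<in>A. h x = b} = m"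
  shows "bernoulli_avg A q (\<lambda>C. F {b\<in>B. \<forall>x\<in>C. h x \<noteq> b}) = bernoulli_avg B ((1 - q) ^ m) F"
  using assms
proof (induction B arbitrary: A F rule: finite_induct)
  case (insert b B)
  let ?A1 = "{x\<in>A. h x = b}" and ?A2 = "{x\<in>A. h x \<noteq> b}"
  have A: "A = ?A1 \<union> ?A2" "?A1 \<inter> ?A2 = {}" "finite ?A1" "finite ?A2"
    using insert.prems by auto
  have c1: "card ?A1 = m" using insert.prems(3) by simp
  \<comment> \<open>The functional is kept general because two are needed: \<open>F\<close> itself
    when the fibre over \<open>b\<close> is hit, and \<open>F\<close> after inserting
    \<open>b\<close> when it is missed.\<close>
  have IH: "bernoulli_avg ?A2 q (\<lambda>C. G {b\<in>B. \<forall>x\<in>C. h x \<noteq> b}) = bernoulli_avg B ((1 - q) ^ m) G" for G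
  proof (rule insert.IH)
    show "card {x \<in> ?A2. h x = b'} = m" if "b' \<in> B" for b'
    proof -
      have "{x \<in> ?A2. h x = b'} = {x\<in>A. h x = b'}" using that insert.hyps by auto
      then show ?thesis using insert.prems(3) that by simp
    qed
  qed (use insert.prems A in auto)
  have "bernoulli_avg A q (\<lambda>C. F {b'\<in>insert b B. \<forall>x\<in>C. h x \<noteq> b'}) =
    bernoulli_avg ?A1 q (\<lambda>C. bernoulli_avg ?A2 q (\<lambda>D. F {b'\<in>insert b B. \<forall>x\<in>C \<union> D. h x \<noteq> b'}))"
    by (subst A(1), subst bernoulli_avg_Un) (use A in auto)
  also have "\<dots> = bernoulli_avg ?A1 q (\<lambda>C. if C = {} then
      bernoulli_avg ?A2 q (\<lambda>D. F (insert b {b'\<in>B. \<forall>x\<in>D. h x \<noteq> b'}))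
      else bernoulli_avg ?A2 q (\<lambda>D. F {b'\<in>B. \<forall>x\<in>D. h x \<noteq> b'}))"
  proof (intro bernoulli_avg_cong)
    fix C assume C: "C \<subseteq> ?A1"
    show "bernoulli_avg ?A2 q (\<lambda>D. F {b'\<in>insert b B. \<forall>x\<in>C \<union> D. h x \<noteq> b'}) =
      (if C = {} then bernoulli_avg ?A2 q (\<lambda>D. F (insert b {b'\<in>B. \<forall>x\<in>D. h x \<noteq> b'}))
      else bernoulli_avg ?A2 q (\<lambda>D. F {b'\<in>B. \<forall>x\<in>D. h x \<noteq> b'}))"
    proof (cases "C = {}")
      case True
      then show ?thesis
        by simp (intro bernoulli_avg_cong arg_cong[where f = F], auto)
    next
      case False
      then have "{b'\<in>insert b B. \<forall>x\<in>C \<union> D. h x \<noteq> b'} = {b'\<in>B. \<forall>x\<in>D. h x \<noteq> b'}" for D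
        using C insert.hyps by auto
      then show ?thesis using False by simp
    qed
  qed
  also have "\<dots> = (1 - q) ^ m * bernoulli_avg B ((1 - q) ^ m) (\<lambda>D. F (insert b D)) +
     (1 - (1 - q) ^ m) * bernoulli_avg B ((1 - q) ^ m) F"
    using A(3) by (simp add: bernoulli_avg_if_empty c1 IH IH[of "\<lambda>D. F (insert b D)"])
  finally show ?case using insert.hyps by (simp add: bernoulli_avg_insert)
qed auto

text \<open>Expectation under the binomial law. The weights are written as Bernstein polynomials so
  that the known sums for these polynomials supply the mean and the second factorial moment.\<close>

definition binomial_avg :: "nat \<Rightarrow> real \<Rightarrow> (nat \<Rightarrow> real) \<Rightarrow> real" where
  "binomial_avg n x f = (\<Sum>k\<le>n. Bernstein n k x * f k)"

lemma bernoulli_avg_card: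
  assumes "finite A"
  shows "bernoulli_avg A q (\<lambda>C. f (card C)) = binomial_avg (card A) q f"
proof -
  have w: "(\<Prod>x\<in>A. if x \<in> C then q else 1 - q) = q ^ card C * (1 - q) ^ (card A - card C)"
    if "C \<subseteq> A" for C
  proof -
    have "(\<Prod>x\<in>A. if x \<in> C then q else 1 - q) = q ^ card (A \<inter> C) * (1 - q) ^ card (A - C)"
      using assms by (simp add: prod.If_cases Diff_eq)
    then show ?thesis using that assms
      by (simp add: Int_absorb1 card_Diff_subset finite_subset)
  qed
  have "bernoulli_avg A q (\<lambda>C. f (card C)) =
     (\<Sum>C\<in>Pow A. q ^ card C * (1 - q) ^ (card A - card C) * f (card C))"
    unfolding bernoulli_avg_def by (intro sum.cong) (auto simp: w)
  also have "\<dots> = (\<Sum>k\<le>card A. \<Sum>C\<in>{C \<in> Pow A. card C = k}. q ^ card C * (1 - q) ^ (card A - card C) * f (card C))"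
    using assms by (subst sum.group) (auto intro: card_mono)
  also have "\<dots> = (\<Sum>k\<le>card A. real (card A choose k) * (q ^ k * (1 - q) ^ (card A - k) * f k))"
  proof (intro sum.cong)
    fix k
    have "card {C \<in> Pow A. card C = k} = card A choose k"
      using n_subsets[OF assms] by (simp add: Pow_def)
    then show "(\<Sum>C\<in>{C \<in> Pow A. card C = k}. q ^ card C * (1 - q) ^ (card A - card C) * f (card C)) =
       real (card A choose k) * (q ^ k * (1 - q) ^ (card A - k) * f k)"
      by simp
  qed auto
  finally show ?thesis unfolding binomial_avg_def Bernstein_def by (simp add: mult_ac)
qed

section \<open>The expected cost as a binomial average\<close>

text \<open>Condition on the entries of the ones. The tests without any one form a Bernoulli set
  \<open>V\<close> with parameter \<open>(1 - q) ^ card X\<close>, and \<open>i\<close> stays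
  undetermined iff its own independent entries avoid \<open>V\<close>. This has probability
  \<open>(1 - q) ^ card V\<close>, whose average is a value of the binomial generating
  function.\<close>

lemma prob_not_sure_zero:
  assumes X: "X \<subseteq> {0..<N}" and i: "i < N" "i \<notin> X"
  shows "bernoulli_avg ({0..<N} \<times> {0..<M}) q (\<lambda>C. of_bool (\<not> sure_zero M C X i)) =
    (1 - q * (1 - q) ^ card X) ^ M"
proof -
  let ?T = "{0..<M}"
  let ?A1 = "X \<times> ?T" and ?A2 = "{i} \<times> ?T"
  let ?V = "\<lambda>C. {a\<in>?T. \<forall>x\<in>C. snd x \<noteq> a}"
  have finX: "finite X" using X finite_subset by blast
  have ns: "\<not> sure_zero M C X i \<longleftrightarrow> (C \<inter> ?A2) \<inter> ({i} \<times> ?V (C \<inter> ?A1)) = {}" for C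
  proof -
    have "\<not> sure_zero M C X i \<longleftrightarrow> (\<forall>a<M. (i, a) \<in> C \<longrightarrow> (\<exists>j\<in>X. (j, a) \<in> C))"
      unfolding sure_zero_def test_out_def by blast
    also have "\<dots> \<longleftrightarrow> (\<forall>a<M. (i, a) \<in> C \<longrightarrow> a \<notin> ?V (C \<inter> ?A1))"
      by (intro all_cong imp_cong refl) force
    also have "\<dots> \<longleftrightarrow> (C \<inter> ?A2) \<inter> ({i} \<times> ?V (C \<inter> ?A1)) = {}"
      by auto
    finally show ?thesis .
  qed
  have "bernoulli_avg ({0..<N} \<times> ?T) q (\<lambda>C. of_bool (\<not> sure_zero M C X i)) =
    bernoulli_avg ({0..<N} \<times> ?T) q (\<lambda>C. (\<lambda>D. of_bool ((D \<inter> ?A2) \<inter> ({i} \<times> ?V (D \<inter> ?A1)) = {})) (C \<inter> (?A1 \<union> ?A2)))"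
    unfolding ns by (intro bernoulli_avg_cong arg_cong[where f = of_bool]) (auto simp: Int_assoc Int_absorb1 Int_absorb2)
  also have "\<dots> = bernoulli_avg (?A1 \<union> ?A2) q (\<lambda>D. of_bool ((D \<inter> ?A2) \<inter> ({i} \<times> ?V (D \<inter> ?A1)) = {}))"
    by (rule bernoulli_avg_marginal) (use X i in auto)
  also have "\<dots> = bernoulli_avg ?A1 q (\<lambda>C. bernoulli_avg ?A2 q (\<lambda>D. of_bool (D \<inter> ({i} \<times> ?V C) = {})))"
  proof (subst bernoulli_avg_Un)
    show "bernoulli_avg ?A1 q (\<lambda>C. bernoulli_avg ?A2 q (\<lambda>D. of_bool (((C \<union> D) \<inter> ?A2) \<inter> ({i} \<times> ?V ((C \<union> D) \<inter> ?A1)) = {})))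
      = bernoulli_avg ?A1 q (\<lambda>C. bernoulli_avg ?A2 q (\<lambda>D. of_bool (D \<inter> ({i} \<times> ?V C) = {})))"
    proof (intro bernoulli_avg_cong)
      fix C D assume "C \<subseteq> ?A1" "D \<subseteq> ?A2"
      then have "(C \<union> D) \<inter> ?A2 = D" "(C \<union> D) \<inter> ?A1 = C" using i by auto
      then show "of_bool (((C \<union> D) \<inter> ?A2) \<inter> ({i} \<times> ?V ((C \<union> D) \<inter> ?A1)) = {}) =
        (of_bool (D \<inter> ({i} \<times> ?V C) = {}) :: real)" by simp
    qed
  qed (use finX i in auto)
  also have "\<dots> = bernoulli_avg ?A1 q (\<lambda>C. (1 - q) ^ card (?V C))"
    by (intro bernoulli_avg_cong, subst bernoulli_avg_disjoint) auto
  also have "\<dots> = bernoulli_avg ?T ((1 - q) ^ card X) (\<lambda>V. (1 - q) ^ card V)"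
  proof (rule bernoulli_avg_empty_fibres)
    fix b assume "b \<in> ?T"
    then have "{x \<in> ?A1. snd x = b} = X \<times> {b}" by auto
    then show "card {x \<in> ?A1. snd x = b} = card X" by (simp add: card_cartesian_product)
  qed (use finX in auto)
  also have "\<dots> = (1 - q * (1 - q) ^ card X) ^ M"
    by (simp add: bernoulli_avg_power algebra_simps)
  finally show ?thesis .
qed

text \<open>To be read with \<open>Y\<close> the zeros, \<open>Z\<close> the negative tests and
  \<open>S\<close> the tests that might certify a one: the event says that each of them contains a
  zero which is not a sure zero. Condition on the block \<open>Y \<times> Z\<close>. It determines
  the set \<open>W\<close> of variables avoiding \<open>Z\<close>, and given \<open>W\<close> the
  tests in \<open>S\<close> meet it independently, each with probability
  \<open>1 - (1 - q) ^ card W\<close>.\<close>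

lemma prob_all_tests_hit:
  assumes "finite Y" "finite T" "S \<subseteq> T" "Z \<subseteq> T" "S \<inter> Z = {}"
  shows "bernoulli_avg (Y \<times> T) q
      (\<lambda>C. of_bool (\<forall>a\<in>S. \<exists>j\<in>Y. (j, a) \<in> C \<and> (\<forall>b\<in>Z. (j, b) \<notin> C))) =
    binomial_avg (card Y) ((1 - q) ^ card Z) (\<lambda>w. (1 - (1 - q) ^ w) ^ card S)"
proof -
  let ?A1 = "Y \<times> Z" and ?A2 = "Y \<times> S"
  let ?W = "\<lambda>C. {j\<in>Y. \<forall>x\<in>C. fst x \<noteq> j}"
  let ?R = "\<lambda>C. {a\<in>S. \<forall>x\<in>C. snd x \<noteq> a}"
  let ?f = "\<lambda>C. of_bool (?R (C \<inter> ?A2 \<inter> (?W (C \<inter> ?A1) \<times> S)) = {}) :: real"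
  have fin: "finite S" "finite Z" using assms by (auto intro: finite_subset)
  have "bernoulli_avg (Y \<times> T) q
      (\<lambda>C. of_bool (\<forall>a\<in>S. \<exists>j\<in>Y. (j, a) \<in> C \<and> (\<forall>b\<in>Z. (j, b) \<notin> C))) =
     bernoulli_avg (Y \<times> T) q (\<lambda>C. ?f (C \<inter> (?A1 \<union> ?A2)))"
  proof (intro bernoulli_avg_cong arg_cong[where f = of_bool])
    fix C
    have e: "C \<inter> (?A1 \<union> ?A2) \<inter> ?A2 = C \<inter> ?A2" "C \<inter> (?A1 \<union> ?A2) \<inter> ?A1 = C \<inter> ?A1" by auto
    show "(\<forall>a\<in>S. \<exists>j\<in>Y. (j, a) \<in> C \<and> (\<forall>b\<in>Z. (j, b) \<notin> C)) \<longleftrightarrow>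
      ?R (C \<inter> (?A1 \<union> ?A2) \<inter> ?A2 \<inter> (?W (C \<inter> (?A1 \<union> ?A2) \<inter> ?A1) \<times> S)) = {}"
    proof -
      have W: "j \<in> ?W (C \<inter> ?A1) \<longleftrightarrow> j \<in> Y \<and> (\<forall>b\<in>Z. (j, b) \<notin> C)" for j by force
      have "?R (C \<inter> ?A2 \<inter> (?W (C \<inter> ?A1) \<times> S)) = {} \<longleftrightarrow>
          (\<forall>a\<in>S. \<exists>j\<in>?W (C \<inter> ?A1). (j, a) \<in> C)" by force
      also have "\<dots> \<longleftrightarrow> (\<forall>a\<in>S. \<exists>j\<in>Y. (j, a) \<in> C \<and> (\<forall>b\<in>Z. (j, b) \<notin> C))"
        unfolding Bex_def W by blast
      finally show ?thesis unfolding e ..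
    qed
  qed
  also have "\<dots> = bernoulli_avg (?A1 \<union> ?A2) q ?f"
    by (rule bernoulli_avg_marginal) (use assms in auto)
  also have "\<dots> = bernoulli_avg ?A1 q (\<lambda>C. bernoulli_avg ?A2 q (\<lambda>D. of_bool (?R (D \<inter> (?W C \<times> S)) = {})))"
  proof (subst bernoulli_avg_Un)
    show "bernoulli_avg ?A1 q (\<lambda>C. bernoulli_avg ?A2 q (\<lambda>D. ?f (C \<union> D))) =
      bernoulli_avg ?A1 q (\<lambda>C. bernoulli_avg ?A2 q (\<lambda>D. of_bool (?R (D \<inter> (?W C \<times> S)) = {})))"
    proof (intro bernoulli_avg_cong)
      fix C D assume "C \<subseteq> ?A1" "D \<subseteq> ?A2"
      then have "(C \<union> D) \<inter> ?A2 = D" "(C \<union> D) \<inter> ?A1 = C" using assms(5) by auto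
      then show "?f (C \<union> D) = of_bool (?R (D \<inter> (?W C \<times> S)) = {})" by simp
    qed
  qed (use fin assms in auto)
  also have "\<dots> = bernoulli_avg ?A1 q (\<lambda>C. (1 - (1 - q) ^ card (?W C)) ^ card S)"
  proof (intro bernoulli_avg_cong)
    fix C
    let ?U = "?W C"
    have finU: "finite ?U" using assms(1) by simp
    have "bernoulli_avg ?A2 q (\<lambda>D. of_bool (?R (D \<inter> (?U \<times> S)) = {})) =
      bernoulli_avg (?U \<times> S) q (\<lambda>D. of_bool (?R D = {}))"
      by (rule bernoulli_avg_marginal) (use assms fin in auto)
    also have "\<dots> = bernoulli_avg S ((1 - q) ^ card ?U) (\<lambda>R. of_bool (R = {}))"
    proof (rule bernoulli_avg_empty_fibres)
      fix b assume "b \<in> S"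
      then have "{x \<in> ?U \<times> S. snd x = b} = ?U \<times> {b}" by auto
      then show "card {x \<in> ?U \<times> S. snd x = b} = card ?U" by (simp add: card_cartesian_product)
    qed (use fin finU in auto)
    also have "\<dots> = (1 - (1 - q) ^ card ?U) ^ card S"
      using bernoulli_avg_if_empty[of S "(1 - q) ^ card ?U" 1 0] fin by (simp add: of_bool_def)
    finally show "bernoulli_avg ?A2 q (\<lambda>D. of_bool (?R (D \<inter> (?U \<times> S)) = {})) =
      (1 - (1 - q) ^ card ?U) ^ card S" .
  qed
  also have "\<dots> = bernoulli_avg Y ((1 - q) ^ card Z) (\<lambda>W. (1 - (1 - q) ^ card W) ^ card S)"
  proof (rule bernoulli_avg_empty_fibres)
    fix b assume "b \<in> Y"
    then have "{x \<in> ?A1. fst x = b} = {b} \<times> Z" by auto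
    then show "card {x \<in> ?A1. fst x = b} = card Z" by (simp add: card_cartesian_product)
  qed (use fin assms in auto)
  finally show ?thesis
    using assms(1) by (simp add: bernoulli_avg_card[where f = "\<lambda>w. (1 - (1 - q) ^ w) ^ card S"])
qed

text \<open>
  For a configuration with \<open>k\<close> ones and a fixed one \<open>i\<close>: \<open>v\<close> counts the tests containing no other one,
  \<open>s\<close> those among them that contain \<open>i\<close> (so \<open>v - s\<close> tests are negative), and \<open>w\<close> the zeros
  avoiding all negative tests.  Each of the \<open>s\<close> tests must meet one of these \<open>w\<close> zeros.
\<close>
definition one_miss_prob :: "nat \<Rightarrow> nat \<Rightarrow> real \<Rightarrow> nat \<Rightarrow> real" where
  "one_miss_prob N M q k = binomial_avg M ((1 - q) ^ (k - 1)) (\<lambda>v. binomial_avg v q (\<lambda>s.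
     binomial_avg (N - k) ((1 - q) ^ (v - s)) (\<lambda>w. (1 - (1 - q) ^ w) ^ s)))"

text \<open>The matrix splits into three independent blocks: the other ones, the variable
  \<open>i\<close>, and the zeros. The first block determines the set \<open>V\<close> of tests free
  of other ones, the second the part \<open>S\<close> of \<open>V\<close> containing
  \<open>i\<close>. The negative tests are then exactly \<open>V - S\<close>, and what remains is an
  event about the third block alone.\<close>

lemma prob_not_sure_one:
  assumes X: "X \<subseteq> {0..<N}" and i: "i \<in> X"
  shows "bernoulli_avg ({0..<N} \<times> {0..<M}) q (\<lambda>C. of_bool (\<not> sure_one N M C X i)) =
    one_miss_prob N M q (card X)"
proof -
  let ?T = "{0..<M}" and ?X = "X - {i}" and ?Y = "{0..<N} - X"
  let ?A1 = "?X \<times> ?T" and ?A2 = "{i} \<times> ?T" and ?A3 = "?Y \<times> ?T"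
  let ?V = "\<lambda>C. {a\<in>?T. \<forall>x\<in>C. snd x \<noteq> a}"
  let ?h = "\<lambda>V S C. of_bool (\<forall>a\<in>S. \<exists>j\<in>?Y. (j, a) \<in> C \<and> (\<forall>b\<in>V - S. (j, b) \<notin> C)) :: real"
  let ?S = "\<lambda>V D. {a\<in>V. (i, a) \<in> D}"
  have finX: "finite X" using X finite_subset by blast
  have so: "(\<not> sure_one N M (C \<union> (D \<union> E)) X i) \<longleftrightarrow>
      (\<forall>a\<in>?S (?V C) D. \<exists>j\<in>?Y. (j, a) \<in> E \<and> (\<forall>b\<in>?V C - ?S (?V C) D. (j, b) \<notin> E))"
    if "C \<subseteq> ?A1" "D \<subseteq> ?A2" "E \<subseteq> ?A3" for C D E
  proof -
    let ?G = "C \<union> (D \<union> E)"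
    define V where "V = ?V C"
    define S where "S = ?S V D"
    have notV: "a \<notin> V \<longleftrightarrow> (\<exists>j\<in>?X. (j, a) \<in> C)" if "a < M" for a
      using \<open>C \<subseteq> ?A1\<close> that unfolding V_def by force
    have VM: "a < M" if "a \<in> V" for a
      using that unfolding V_def by auto
    have S: "a \<in> S \<longleftrightarrow> a \<in> V \<and> (i, a) \<in> D" for a
      unfolding S_def by blast
    have iG: "(i, a) \<in> ?G \<longleftrightarrow> (i, a) \<in> D" for a
      using \<open>C \<subseteq> ?A1\<close> \<open>E \<subseteq> ?A3\<close> i by blast
    have YG: "(j, a) \<in> ?G \<longleftrightarrow> (j, a) \<in> E" if "j \<in> ?Y" for j a
      using \<open>C \<subseteq> ?A1\<close> \<open>D \<subseteq> ?A2\<close> that i by blast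
    have XG: "(j, a) \<in> ?G \<longleftrightarrow> (j, a) \<in> C" if "j \<in> ?X" for j a
      using \<open>E \<subseteq> ?A3\<close> \<open>D \<subseteq> ?A2\<close> that i by blast
    have "test_out ?G X a \<longleftrightarrow> (i, a) \<in> ?G \<or> (\<exists>j\<in>?X. (j, a) \<in> ?G)" for a
      unfolding test_out_def using i by blast
    then have out: "test_out ?G X a \<longleftrightarrow> (i, a) \<in> D \<or> a \<notin> V" if "a < M" for a
      using notV[OF that] XG iG by (simp del: Un_iff)
    \<comment> \<open>A one makes all of its tests positive, so a test containing another one can
      never certify \<open>i\<close>; only tests in \<open>V\<close> are left.\<close>
    have szX: "\<not> sure_zero M ?G X j" if "j \<in> X" for j
      using that unfolding sure_zero_def test_out_def by blast
    have szY: "sure_zero M ?G X j \<longleftrightarrow> (\<exists>b\<in>V - S. (j, b) \<in> E)" if "j \<in> ?Y" for j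
      unfolding sure_zero_def YG[OF that] using out VM S by blast
    have X_or_Y: "(\<exists>j<N. j \<noteq> i \<and> P j) \<longleftrightarrow> (\<exists>j\<in>?X. P j) \<or> (\<exists>j\<in>?Y. P j)" for P
      using X i by force
    have eX: "(\<exists>j\<in>?X. (j, a) \<in> ?G \<and> \<not> sure_zero M ?G X j) \<longleftrightarrow> a \<notin> V" if "a < M" for a
      unfolding notV[OF that] using XG szX by (intro bex_cong refl) simp
    have eY: "(\<exists>j\<in>?Y. (j, a) \<in> ?G \<and> \<not> sure_zero M ?G X j) \<longleftrightarrow>
         (\<exists>j\<in>?Y. (j, a) \<in> E \<and> (\<forall>b\<in>V - S. (j, b) \<notin> E))" for a
      using YG szY by (intro bex_cong refl) simp
    have "(\<not> sure_one N M ?G X i) \<longleftrightarrow>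
      (\<forall>a<M. (i, a) \<in> D \<longrightarrow> (\<exists>j<N. j \<noteq> i \<and> ((j, a) \<in> ?G \<and> \<not> sure_zero M ?G X j)))"
      unfolding sure_one_def iG using i by blast
    also have "\<dots> \<longleftrightarrow> (\<forall>a<M. (i, a) \<in> D \<longrightarrow> a \<notin> V \<or>
       (\<exists>j\<in>?Y. (j, a) \<in> E \<and> (\<forall>b\<in>V - S. (j, b) \<notin> E)))"
      unfolding X_or_Y eY using eX by (intro all_cong imp_cong refl) simp
    also have "\<dots> \<longleftrightarrow> (\<forall>a\<in>S. \<exists>j\<in>?Y. (j, a) \<in> E \<and> (\<forall>b\<in>V - S. (j, b) \<notin> E))"
      unfolding Ball_def S using VM by meson
    finally show ?thesis unfolding S_def V_def .
  qed
  have cY: "card ?Y = N - card X"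
    using X finX by (simp add: card_Diff_subset)
  define K where "K = (\<lambda>v s. binomial_avg (N - card X) ((1 - q) ^ (v - s)) (\<lambda>w. (1 - (1 - q) ^ w) ^ s))"
  have A: "{0..<N} \<times> ?T = ?A1 \<union> (?A2 \<union> ?A3)" using X i by auto
  have "bernoulli_avg ({0..<N} \<times> ?T) q (\<lambda>C. of_bool (\<not> sure_one N M C X i)) =
    bernoulli_avg ?A1 q (\<lambda>C. bernoulli_avg ?A2 q (\<lambda>D. bernoulli_avg ?A3 q (\<lambda>E.
      of_bool (\<not> sure_one N M (C \<union> (D \<union> E)) X i))))"
    unfolding A using finX i by (subst bernoulli_avg_Un, force, force, force, subst bernoulli_avg_Un) auto
  also have "\<dots> = bernoulli_avg ?A1 q (\<lambda>C. bernoulli_avg ?A2 q (\<lambda>D. bernoulli_avg ?A3 q (?h (?V C) (?S (?V C) D))))"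
    by (intro bernoulli_avg_cong arg_cong[where f = of_bool] so)
  also have "\<dots> = bernoulli_avg ?A1 q (\<lambda>C. binomial_avg (card (?V C)) q (K (card (?V C))))"
  proof (intro bernoulli_avg_cong)
    fix C
    define V where "V = ?V C"
    have V: "V \<subseteq> ?T" "finite V" by (auto simp: V_def)
    have inj: "inj_on (Pair i) V" by (auto simp: inj_on_def)
    have "bernoulli_avg ?A2 q (\<lambda>D. bernoulli_avg ?A3 q (?h V (?S V D))) =
      bernoulli_avg ?A2 q (\<lambda>D. K (card V) (card (?S V D)))"
    proof (intro bernoulli_avg_cong)
      fix D
      have sub: "?S V D \<subseteq> V" by auto
      then have "card (V - ?S V D) = card V - card (?S V D)"
        using V by (simp add: card_Diff_subset finite_subset)
      moreover have "bernoulli_avg ?A3 q (?h V (?S V D)) =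
        binomial_avg (card ?Y) ((1 - q) ^ card (V - ?S V D)) (\<lambda>w. (1 - (1 - q) ^ w) ^ card (?S V D))"
        by (rule prob_all_tests_hit) (use V in auto)
      ultimately show "bernoulli_avg ?A3 q (?h V (?S V D)) = K (card V) (card (?S V D))"
        by (simp add: K_def cY)
    qed
    \<comment> \<open>Only the entries of \<open>i\<close> at tests in \<open>V\<close> are counted;
      after restriction to them, \<open>Pair i\<close> identifies these entries with a random subset
      of \<open>V\<close>.\<close>
    also have "\<dots> = bernoulli_avg ?A2 q (\<lambda>D. (\<lambda>D'. K (card V) (card (?S V D'))) (D \<inter> (Pair i ` V)))"
      by (intro bernoulli_avg_cong arg_cong[where f = "K (card V)"] arg_cong[where f = card]) auto
    also have "\<dots> = bernoulli_avg (Pair i ` V) q (\<lambda>D. K (card V) (card (?S V D)))"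
      by (rule bernoulli_avg_marginal) (use V in auto)
    also have "\<dots> = bernoulli_avg V q (\<lambda>S. K (card V) (card (?S V (Pair i ` S))))"
      by (rule bernoulli_avg_image[OF V(2) inj])
    also have "\<dots> = bernoulli_avg V q (\<lambda>S. K (card V) (card S))"
      by (intro bernoulli_avg_cong arg_cong[where f = "K (card V)"] arg_cong[where f = card]) auto
    also have "\<dots> = binomial_avg (card V) q (K (card V))"
      by (rule bernoulli_avg_card[OF V(2)])
    finally show "bernoulli_avg ?A2 q (\<lambda>D. bernoulli_avg ?A3 q (?h (?V C) (?S (?V C) D))) =
       binomial_avg (card (?V C)) q (K (card (?V C)))" unfolding V_def .
  qed
  also have "\<dots> = bernoulli_avg ?T ((1 - q) ^ card ?X) (\<lambda>V. binomial_avg (card V) q (K (card V)))"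
  proof (rule bernoulli_avg_empty_fibres)
    fix b assume "b \<in> ?T"
    then have "{x \<in> ?A1. snd x = b} = ?X \<times> {b}" by auto
    then show "card {x \<in> ?A1. snd x = b} = card ?X" by (simp add: card_cartesian_product)
  qed (use finX in auto)
  also have "\<dots> = one_miss_prob N M q (card X)"
    unfolding one_miss_prob_def K_def[symmetric]
    using bernoulli_avg_card[of ?T "(1 - q) ^ card ?X" "\<lambda>v. binomial_avg v q (K v)"] finX i
    by (simp add: K_def)
  finally show ?thesis .
qed

text \<open>Averaging over the matrix before the configuration leaves an integrand that depends on
  \<open>X\<close> only through \<open>card X\<close>, so the outer average becomes binomial. The
  identity holds for all \<open>N\<close> and \<open>p\<close>, including the cases where a
  denominator vanishes.\<close>

lemma avg_cost_eq:
  fixes N p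
  defines "M \<equiv> Mtil N p"
  defines "q \<equiv> real (Ltil p) / real M"
  shows "avg_cost N p = (real M + binomial_avg N p (\<lambda>k. real (N - k) * (1 - q * (1 - q) ^ k) ^ M
     + real k * one_miss_prob N M q k)) / (real N * p * \<bar>ln p\<bar>)"
proof -
  let ?A = "{0..<N} \<times> {0..<M}"
  let ?c = "real N * p * \<bar>ln p\<bar>"
  have PP: "PP N M (Ltil p) C = (\<Prod>x\<in>?A. if x \<in> C then q else 1 - q)" for C
    unfolding PP_def q_def by (subst prod.swap) (simp add: prod.cartesian_product)
  have Tc: "Tcost N M C p = real M + bernoulli_avg {0..<N} p (\<lambda>X.
     real (card (U0 N M C X) + card (U1 N M C X)))" for C
    unfolding Tcost_def bernoulli_avg_def mu_def by simp
  have U: "bernoulli_avg ?A q (\<lambda>C. real (card (U0 N M C X) + card (U1 N M C X))) =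
     real (N - card X) * (1 - q * (1 - q) ^ card X) ^ M + real (card X) * one_miss_prob N M q (card X)"
    if X: "X \<subseteq> {0..<N}" for X
  proof -
    have finX: "finite X" using X finite_subset by blast
    have "U0 N M C X = {i\<in>{0..<N} - X. \<not> sure_zero M C X i}" for C by (auto simp: U0_def)
    then have c0: "real (card (U0 N M C X)) = (\<Sum>i\<in>{0..<N} - X. of_bool (\<not> sure_zero M C X i))" for C
      by (simp add: sum_of_bool_eq Int_def)
    have "U1 N M C X = {i\<in>X. \<not> sure_one N M C X i}" for C using X by (auto simp: U1_def)
    then have c1: "real (card (U1 N M C X)) = (\<Sum>i\<in>X. of_bool (\<not> sure_one N M C X i))" for C
      using finX by (simp add: sum_of_bool_eq Int_def)
    have "bernoulli_avg ?A q (\<lambda>C. real (card (U0 N M C X) + card (U1 N M C X))) =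
      (\<Sum>i\<in>{0..<N} - X. bernoulli_avg ?A q (\<lambda>C. of_bool (\<not> sure_zero M C X i)))
      + (\<Sum>i\<in>X. bernoulli_avg ?A q (\<lambda>C. of_bool (\<not> sure_one N M C X i)))"
      unfolding of_nat_add c0 c1 bernoulli_avg_add bernoulli_avg_sum ..
    also have "(\<Sum>i\<in>{0..<N} - X. bernoulli_avg ?A q (\<lambda>C. of_bool (\<not> sure_zero M C X i))) =
      real (N - card X) * (1 - q * (1 - q) ^ card X) ^ M"
      using X finX by (simp add: prob_not_sure_zero card_Diff_subset)
    also have "(\<Sum>i\<in>X. bernoulli_avg ?A q (\<lambda>C. of_bool (\<not> sure_one N M C X i))) =
      real (card X) * one_miss_prob N M q (card X)"
      using X by (simp add: prob_not_sure_one)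
    finally show ?thesis .
  qed
  have "avg_cost N p = bernoulli_avg ?A q (\<lambda>C. Tcost N M C p / ?c)"
    unfolding avg_cost_def M_def[symmetric] PP bernoulli_avg_def ..
  also have "\<dots> = (real M + bernoulli_avg {0..<N} p (\<lambda>X. bernoulli_avg ?A q (\<lambda>C.
     real (card (U0 N M C X) + card (U1 N M C X))))) / ?c"
    unfolding bernoulli_avg_divide Tc bernoulli_avg_add by (subst bernoulli_avg_swap) simp
  also have "bernoulli_avg {0..<N} p (\<lambda>X. bernoulli_avg ?A q (\<lambda>C.
     real (card (U0 N M C X) + card (U1 N M C X)))) = bernoulli_avg {0..<N} p (\<lambda>X.
     real (N - card X) * (1 - q * (1 - q) ^ card X) ^ M + real (card X) * one_miss_prob N M q (card X))"
    by (intro bernoulli_avg_cong U)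
  also have "\<dots> = binomial_avg N p (\<lambda>k. real (N - k) * (1 - q * (1 - q) ^ k) ^ M
     + real k * one_miss_prob N M q k)"
    using bernoulli_avg_card[of "{0..<N}" p "\<lambda>k. real (N - k) * (1 - q * (1 - q) ^ k) ^ M
     + real k * one_miss_prob N M q k"] by simp
  finally show ?thesis .
qed

section \<open>Concentration of binomial averages\<close>

lemma binomial_avg_mono:
  assumes "0 \<le> x" "x \<le> 1" "\<And>k. k \<le> n \<Longrightarrow> f k \<le> g k"
  shows "binomial_avg n x f \<le> binomial_avg n x g"
  unfolding binomial_avg_def by (intro sum_mono mult_left_mono) (use assms Bernstein_nonneg in auto)

lemma binomial_avg_const [simp]: "binomial_avg n x (\<lambda>k. c) = c"
  unfolding binomial_avg_def by (simp flip: sum_distrib_right)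

lemma binomial_avg_add: "binomial_avg n x (\<lambda>k. f k + g k) = binomial_avg n x f + binomial_avg n x g"
  unfolding binomial_avg_def by (simp add: algebra_simps sum.distrib)

lemma binomial_avg_diff: "binomial_avg n x (\<lambda>k. f k - g k) = binomial_avg n x f - binomial_avg n x g"
  unfolding binomial_avg_def by (simp add: algebra_simps sum_subtractf)

lemma binomial_avg_mult: "binomial_avg n x (\<lambda>k. c * f k) = c * binomial_avg n x f"
  unfolding binomial_avg_def by (simp add: sum_distrib_left mult_ac)

lemma binomial_avg_divide: "binomial_avg n x (\<lambda>k. f k / c) = binomial_avg n x f / c"
  unfolding binomial_avg_def by (simp add: sum_divide_distrib)

lemma binomial_avg_mean: "binomial_avg n x real = real n * x"
  using sum_k_Bernstein[of n x] unfolding binomial_avg_def by (simp add: mult.commute)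

lemma binomial_avg_power: "binomial_avg n x (\<lambda>k. y ^ k) = (1 - x + x * y) ^ n"
  using bernoulli_avg_card[of "{..<n}" x "\<lambda>k. y ^ k"] by (simp add: bernoulli_avg_power)

lemma binomial_avg_variance: "binomial_avg n x (\<lambda>k. (real k - real n * x)\<^sup>2) = real n * x * (1 - x)"
proof -
  have "binomial_avg n x (\<lambda>k. (real k - real n * x)\<^sup>2) =
    binomial_avg n x (\<lambda>k. real k * (real k - 1) + ((1 - 2 * (real n * x)) * real k + (real n * x)\<^sup>2))"
    by (simp add: power2_eq_square algebra_simps)
  also have "\<dots> = binomial_avg n x (\<lambda>k. real k * (real k - 1)) + ((1 - 2 * (real n * x)) * (real n * x) + (real n * x)\<^sup>2)"
    by (simp only: binomial_avg_add binomial_avg_mult binomial_avg_mean binomial_avg_const)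
  also have "binomial_avg n x (\<lambda>k. real k * (real k - 1)) = real n * (real n - 1) * x\<^sup>2"
    using sum_kk_Bernstein[of n x] unfolding binomial_avg_def by (simp add: mult_ac)
  finally show ?thesis by (simp add: power2_eq_square algebra_simps)
qed

lemma binomial_avg_abs_le:
  assumes "0 \<le> x" "x \<le> 1" "\<And>k. k \<le> n \<Longrightarrow> \<bar>f k\<bar> \<le> g k"
  shows "\<bar>binomial_avg n x f\<bar> \<le> binomial_avg n x g"
proof -
  have "binomial_avg n x (\<lambda>k. - 1 * f k) \<le> binomial_avg n x g"
    using assms by (intro binomial_avg_mono) (auto simp: abs_le_iff)
  moreover have "binomial_avg n x f \<le> binomial_avg n x g"
    using assms by (intro binomial_avg_mono) (auto simp: abs_le_iff)
  ultimately show ?thesis unfolding binomial_avg_mult by linarith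
qed

text \<open>Pointwise, \<open>\<bar>f k - l\<bar>\<close> is at most \<open>E\<close> plus
  \<open>D\<close> times the squared deviation of \<open>k\<close> from the mean over the square of
  \<open>t\<close>: inside the window \<open>E\<close> suffices, outside it the quotient is at least
  1. Averaging this majorant needs only the variance.\<close>

lemma binomial_avg_chebyshev:
  assumes x: "0 \<le> x" "x \<le> 1" and t: "t > 0" and E: "0 \<le> E"
    and near: "\<And>k. k \<le> n \<Longrightarrow> \<bar>real k - real n * x\<bar> \<le> t \<Longrightarrow> \<bar>f k - l\<bar> \<le> E"
    and bd: "\<And>k. k \<le> n \<Longrightarrow> \<bar>f k - l\<bar> \<le> D"
  shows "\<bar>binomial_avg n x f - l\<bar> \<le> E + D * real n / t\<^sup>2"
proof -
  have D0: "0 \<le> D" using bd[of 0] by simp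
  have "binomial_avg n x f - l = binomial_avg n x (\<lambda>k. f k - l)"
    by (simp add: binomial_avg_diff)
  also have "\<bar>\<dots>\<bar> \<le> binomial_avg n x (\<lambda>k. E + D / t\<^sup>2 * (real k - real n * x)\<^sup>2)"
  proof (rule binomial_avg_abs_le[OF x])
    fix k assume k: "k \<le> n"
    show "\<bar>f k - l\<bar> \<le> E + D / t\<^sup>2 * (real k - real n * x)\<^sup>2"
    proof (cases "\<bar>real k - real n * x\<bar> \<le> t")
      case True
      have "0 \<le> D / t\<^sup>2 * (real k - real n * x)\<^sup>2" using D0 by simp
      then show ?thesis using near[OF k True] by linarith
    next
      case False
      then have "t\<^sup>2 \<le> (real k - real n * x)\<^sup>2"
        using t by (simp add: abs_le_square_iff[symmetric])
      then have "D * t\<^sup>2 \<le> D * (real k - real n * x)\<^sup>2" using D0 by (rule mult_left_mono)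
      then have "D \<le> D / t\<^sup>2 * (real k - real n * x)\<^sup>2" using t by (simp add: field_simps)
      then show ?thesis using bd[OF k] E by linarith
    qed
  qed
  also have "\<dots> = E + D / t\<^sup>2 * (real n * (x * (1 - x)))"
    by (simp only: binomial_avg_add binomial_avg_mult binomial_avg_variance binomial_avg_const mult.assoc)
  also have "x * (1 - x) \<le> 1" using x by (simp add: mult_le_one)
  then have "E + D / t\<^sup>2 * (real n * (x * (1 - x))) \<le> E + D / t\<^sup>2 * (real n * 1)"
    using D0 by (intro add_left_mono mult_left_mono) auto
  finally show ?thesis by simp
qed

text \<open>
  Concentration in sequential form: the hypothesis on \<open>f\<close> is only about sequences of the typical
  order, so that nested averages can be evaluated one level at a time.
\<close>
lemma binomial_avg_tendsto:
  fixes f :: "nat \<Rightarrow> nat \<Rightarrow> real" and n m :: "nat \<Rightarrow> nat"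
  assumes x: "eventually (\<lambda>N. 0 \<le> x N \<and> x N \<le> 1) sequentially"
    and m: "filterlim m at_top sequentially"
    and nm: "eventually (\<lambda>N. n N \<le> m N) sequentially"
    and y: "(\<lambda>N. real (n N) * x N / real (m N)) \<longlonglongrightarrow> y"
    and bd: "eventually (\<lambda>N. \<forall>k\<le>n N. \<bar>f N k\<bar> \<le> B) sequentially"
    and lim: "\<And>k. (\<And>N. k N \<le> n N) \<Longrightarrow> (\<lambda>N. real (k N) / real (m N)) \<longlonglongrightarrow> y \<Longrightarrow>
       (\<lambda>N. f N (k N)) \<longlonglongrightarrow> l"
  shows "(\<lambda>N. binomial_avg (n N) (x N) (f N)) \<longlonglongrightarrow> l"
proof -
  \<comment> \<open>The exponent 3/4 lies strictly between 1/2 and 1: the window is small compared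
    with \<open>m\<close>, so its points have the limiting ratio \<open>y\<close>, but large
    compared with the standard deviation, so that m / t^2 tends to 0.\<close>
  define t where "t = (\<lambda>N. real (m N) powr (3/4))"
  define K where "K = (\<lambda>N. {k. k \<le> n N \<and> \<bar>real k - real (n N) * x N\<bar> \<le> t N})"
  \<comment> \<open>A worst point of the window, maximising \<open>\<bar>f N k - l\<bar>\<close>.
    The hypothesis for this single sequence then controls the whole window. The default 0 keeps
    \<open>k N \<le> n N\<close> when the window is empty.\<close>
  define k where "k = (\<lambda>N. if K N = {} then 0 else arg_min_on (\<lambda>k. - \<bar>f N k - l\<bar>) (K N))"
  have finK: "finite (K N)" for N unfolding K_def by simp
  have kK: "k N \<in> K N" if "K N \<noteq> {}" for N
    unfolding k_def using that finK by (simp add: arg_min_if_finite(1))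
  have kmax: "\<bar>f N j - l\<bar> \<le> \<bar>f N (k N) - l\<bar>" if "j \<in> K N" for j N
  proof -
    have "K N \<noteq> {}" using that by auto
    then show ?thesis unfolding k_def using arg_min_if_finite(2)[OF finK, of N "\<lambda>k. - \<bar>f N k - l\<bar>"] that
      by (auto simp: not_less)
  qed
  have kn: "k N \<le> n N" for N
    using kK[of N] by (cases "K N = {}") (auto simp: k_def K_def)
  have mr: "filterlim (\<lambda>N. real (m N)) at_top sequentially"
    using m filterlim_compose filterlim_real_sequentially by blast
  have m1: "eventually (\<lambda>N. 1 \<le> m N) sequentially"
    using m by (auto simp: filterlim_at_top)
  have ne: "eventually (\<lambda>N. K N \<noteq> {}) sequentially"
    using x m1
  proof eventually_elim
    case (elim N)
    let ?j = "nat \<lfloor>real (n N) * x N\<rfloor>"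
    have nx: "0 \<le> real (n N) * x N" "real (n N) * x N \<le> real (n N)"
      using elim by (auto simp: mult_left_le)
    have "real ?j \<le> real (n N) * x N" "real (n N) * x N - real ?j \<le> 1" using nx by linarith+
    moreover have "1 \<le> t N" unfolding t_def using elim by (simp add: ge_one_powr_ge_zero)
    moreover have "?j \<le> n N" using nx by linarith
    ultimately have "?j \<in> K N" unfolding K_def by simp
    then show ?case by blast
  qed
  have q0: "(\<lambda>N. real (m N) powr (-1/4)) \<longlonglongrightarrow> 0"
    by (rule filterlim_compose[OF _ mr]) real_asymp
  have "(\<lambda>N. real (k N) / real (m N) - real (n N) * x N / real (m N)) \<longlonglongrightarrow> 0"
  proof (rule Lim_null_comparison[OF _ q0])
    show "eventually (\<lambda>N. norm (real (k N) / real (m N) - real (n N) * x N / real (m N))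
       \<le> real (m N) powr (-1/4)) sequentially"
      using ne m1
    proof eventually_elim
      case (elim N)
      have "\<bar>real (k N) - real (n N) * x N\<bar> \<le> t N" using kK[of N] elim by (auto simp: K_def)
      then have "\<bar>real (k N) - real (n N) * x N\<bar> / real (m N) \<le> t N / real (m N)"
        by (rule divide_right_mono) simp
      also have "t N / real (m N) = real (m N) powr (3/4) / real (m N) powr 1"
        using elim by (simp add: t_def)
      also have "\<dots> = real (m N) powr (-1/4)" by (subst powr_diff[symmetric]) simp
      finally show ?case by (simp add: diff_divide_distrib[symmetric] abs_divide)
    qed
  qed
  from tendsto_add[OF this y] have "(\<lambda>N. real (k N) / real (m N)) \<longlonglongrightarrow> y" by simp
  from lim[OF kn this] have fk: "(\<lambda>N. \<bar>f N (k N) - l\<bar>) \<longlonglongrightarrow> 0"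
    by (simp add: tendsto_rabs_zero_iff LIM_zero_iff)
  have q1: "(\<lambda>N. (B + \<bar>l\<bar>) * real (m N) powr (-1/2)) \<longlonglongrightarrow> 0"
  proof (rule tendsto_mult_right_zero)
    show "(\<lambda>N. real (m N) powr (-1/2)) \<longlonglongrightarrow> 0"
      by (rule filterlim_compose[OF _ mr]) real_asymp
  qed
  have "(\<lambda>N. binomial_avg (n N) (x N) (f N) - l) \<longlonglongrightarrow> 0"
  proof (rule Lim_null_comparison)
    show "(\<lambda>N. \<bar>f N (k N) - l\<bar> + (B + \<bar>l\<bar>) * real (m N) powr (-1/2)) \<longlonglongrightarrow> 0"
      using tendsto_add[OF fk q1] by simp
    show "eventually (\<lambda>N. norm (binomial_avg (n N) (x N) (f N) - l) \<le>
       \<bar>f N (k N) - l\<bar> + (B + \<bar>l\<bar>) * real (m N) powr (-1/2)) sequentially"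
      using x bd nm m1
    proof eventually_elim
      case (elim N)
      have mp: "real (m N) > 0" using elim by simp
      have bdl: "\<bar>f N j - l\<bar> \<le> B + \<bar>l\<bar>" if "j \<le> n N" for j
        using elim(2) that by (smt (verit))
      have B0: "0 \<le> B + \<bar>l\<bar>" using bdl[of 0] by linarith
      have "\<bar>binomial_avg (n N) (x N) (f N) - l\<bar> \<le> \<bar>f N (k N) - l\<bar> + (B + \<bar>l\<bar>) * real (n N) / (t N)\<^sup>2"
      proof (rule binomial_avg_chebyshev)
        show "\<bar>f N j - l\<bar> \<le> \<bar>f N (k N) - l\<bar>" if "j \<le> n N" "\<bar>real j - real (n N) * x N\<bar> \<le> t N" for j
          using kmax[of j N] that by (simp add: K_def)
        show "0 < t N" using mp by (simp add: t_def)
      qed (use elim bdl in auto)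
      also have "(B + \<bar>l\<bar>) * real (n N) / (t N)\<^sup>2 \<le> (B + \<bar>l\<bar>) * real (m N) / (t N)\<^sup>2"
        using B0 elim by (intro divide_right_mono mult_left_mono) auto
      also have "\<dots> = (B + \<bar>l\<bar>) * (real (m N) powr 1 / real (m N) powr (3/2))"
        using mp by (simp add: t_def powr_power)
      also have "real (m N) powr 1 / real (m N) powr (3/2) = real (m N) powr (-1/2)"
        by (subst powr_diff[symmetric]) simp
      finally show ?case by simp
    qed
  qed
  then show ?thesis by (simp add: LIM_zero_iff)
qed

section \<open>Limits of powers with varying base and exponent\<close>

lemma one_minus_power_tendsto_exp:
  fixes q :: "nat \<Rightarrow> real" and a :: "nat \<Rightarrow> nat"
  assumes q: "q \<longlonglongrightarrow> 0" "eventually (\<lambda>N. 0 \<le> q N) sequentially"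
    and aq: "(\<lambda>N. real (a N) * q N) \<longlonglongrightarrow> z"
  shows "(\<lambda>N. (1 - q N) ^ a N) \<longlonglongrightarrow> exp (- z)"
proof -
  have half: "eventually (\<lambda>N. q N \<le> 1/2) sequentially"
    using order_tendstoD(2)[OF q(1), of "1/2"] by (auto elim: eventually_mono)
  have "(\<lambda>N. real (a N) * ln (1 - q N)) \<longlonglongrightarrow> - z"
  \<comment> \<open>For 0 \<le> q \<le> 1/2 the logarithm of 1 - q lies between - q - 2 q^2 and - q.
    Since a q converges and q tends to 0, the quadratic correction a q^2 vanishes.\<close>
  proof (rule real_tendsto_sandwich)
    show "(\<lambda>N. - (real (a N) * q N) - 2 * (real (a N) * q N * q N)) \<longlonglongrightarrow> - z"
      using tendsto_diff[OF tendsto_minus[OF aq] tendsto_mult[OF tendsto_const[of 2] tendsto_mult[OF aq q(1)]]]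
      by simp
    show "(\<lambda>N. - (real (a N) * q N)) \<longlonglongrightarrow> - z"
      by (rule tendsto_minus[OF aq])
    show "eventually (\<lambda>N. - (real (a N) * q N) - 2 * (real (a N) * q N * q N) \<le> real (a N) * ln (1 - q N)) sequentially"
      using q(2) half
    proof eventually_elim
      case (elim N)
      have "real (a N) * (- q N - 2 * (q N)\<^sup>2) \<le> real (a N) * ln (1 - q N)"
        by (intro mult_left_mono ln_one_minus_pos_lower_bound) (use elim in auto)
      then show ?case by (simp add: algebra_simps power2_eq_square)
    qed
    show "eventually (\<lambda>N. real (a N) * ln (1 - q N) \<le> - (real (a N) * q N)) sequentially"
      using q(2) half
    proof eventually_elim
      case (elim N)
      have "ln (1 + - q N) \<le> - q N" by (rule ln_add_one_self_le_self2) (use elim in auto)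
      then have "real (a N) * ln (1 - q N) \<le> real (a N) * (- q N)" by (intro mult_left_mono) auto
      then show ?case by simp
    qed
  qed
  then have "(\<lambda>N. exp (real (a N) * ln (1 - q N))) \<longlonglongrightarrow> exp (- z)" by (rule tendsto_exp)
  moreover have "eventually (\<lambda>N. exp (real (a N) * ln (1 - q N)) = (1 - q N) ^ a N) sequentially"
    using half by eventually_elim (simp add: exp_of_nat_mult)
  ultimately show ?thesis by (rule Lim_transform_eventually)
qed

text \<open>For \<open>u\<close> in the unit interval, \<open>\<bar>u ^ n - y ^ n\<bar>\<close> is
  at most \<open>\<bar>u - y\<bar> / (1 - y)\<close> uniformly in \<open>n\<close>. Uniformity is
  the point: the exponents arise as counts of order smaller than the number of tests and may be
  unbounded.\<close>

lemma power_diff_tendsto_0: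
  fixes a :: "nat \<Rightarrow> real" and s :: "nat \<Rightarrow> nat"
  assumes a: "a \<longlonglongrightarrow> y" "eventually (\<lambda>N. 0 \<le> a N) sequentially" and y: "y < 1"
  shows "(\<lambda>N. a N ^ s N - y ^ s N) \<longlonglongrightarrow> 0"
proof -
  have y0: "0 \<le> y" using a by (rule tendsto_lowerbound) simp
  have bound: "\<bar>u ^ n - y ^ n\<bar> \<le> \<bar>u - y\<bar> / (1 - y)" if "0 \<le> u" "u \<le> 1" for u n
  proof (induction n)
    case (Suc n)
    have "u ^ Suc n - y ^ Suc n = u ^ n * (u - y) + y * (u ^ n - y ^ n)" by (simp add: algebra_simps)
    also have "\<bar>\<dots>\<bar> \<le> u ^ n * \<bar>u - y\<bar> + y * \<bar>u ^ n - y ^ n\<bar>"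
      using that y0 by (intro order.trans[OF abs_triangle_ineq]) (simp add: abs_mult)
    also have "\<dots> \<le> 1 * \<bar>u - y\<bar> + y * (\<bar>u - y\<bar> / (1 - y))"
      using that y0 Suc.IH by (intro add_mono mult_mono) (auto simp: power_le_one)
    also have "\<dots> = \<bar>u - y\<bar> / (1 - y)" using y by (simp add: field_simps)
    finally show ?case .
  qed (use y in auto)
  have a1: "eventually (\<lambda>N. a N \<le> 1) sequentially"
    using order_tendstoD(2)[OF a(1) y] by (auto elim: eventually_mono)
  show ?thesis
  proof (rule Lim_null_comparison)
    show "eventually (\<lambda>N. norm (a N ^ s N - y ^ s N) \<le> \<bar>a N - y\<bar> / (1 - y)) sequentially"
      using a(2) a1 by eventually_elim (use bound in auto)
    have "(\<lambda>N. \<bar>a N - y\<bar> / (1 - y)) \<longlonglongrightarrow> \<bar>y - y\<bar> / (1 - y)"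
      using y by (intro tendsto_intros a) auto
    then show "(\<lambda>N. \<bar>a N - y\<bar> / (1 - y)) \<longlonglongrightarrow> 0" by simp
  qed
qed

section \<open>The limit for fixed p\<close>

lemma binomial_avg_unit_interval:
  assumes "0 \<le> x" "x \<le> 1" "\<And>k. k \<le> n \<Longrightarrow> 0 \<le> f k \<and> f k \<le> 1"
  shows "0 \<le> binomial_avg n x f \<and> binomial_avg n x f \<le> 1"
  using binomial_avg_mono[of x n "\<lambda>_. 0" f] binomial_avg_mono[of x n f "\<lambda>_. 1"] assms by simp

lemma one_miss_prob_unit_interval:
  assumes "0 \<le> q" "q \<le> 1"
  shows "0 \<le> one_miss_prob N M q k \<and> one_miss_prob N M q k \<le> 1"
  unfolding one_miss_prob_def
  by (intro binomial_avg_unit_interval) (use assms in \<open>auto simp: power_le_one\<close>)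

text \<open>\<open>\<Lambda>\<close> is the limiting mean number of tests per variable and
  \<open>\<kappa>\<close> that of variables per test. In the limit, \<open>a\<close> is the
  probability that a test contains no other one, and \<open>\<omega>\<close> the fraction of
  variables that are zeros avoiding all negative tests. A test certifies \<open>i\<close> if it
  contains \<open>i\<close>, no other one and none of these zeros, so the mean number of certifying
  tests tends to \<open>a * \<Lambda> * exp (- (\<omega> * \<kappa>))\<close>; the limit is the
  Poisson probability of having none.\<close>

lemma one_miss_prob_tendsto:
  fixes q :: "nat \<Rightarrow> real" and M k :: "nat \<Rightarrow> nat" and p \<kappa> \<Lambda> :: real
  defines "a \<equiv> exp (- (p * \<kappa>))"
  defines "\<omega> \<equiv> (1 - p) * exp (- (a * \<Lambda>))"
  assumes M: "filterlim M at_top sequentially"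
    and q: "q \<longlonglongrightarrow> 0" "\<And>N. 0 \<le> q N"
    and Mq: "(\<lambda>N. real (M N) * q N) \<longlonglongrightarrow> \<Lambda>"
    and Nq: "(\<lambda>N. real N * q N) \<longlonglongrightarrow> \<kappa>"
    and k: "(\<lambda>N. real (k N) / real N) \<longlonglongrightarrow> p" "\<And>N. k N \<le> N"
    and p: "0 < p"
  shows "(\<lambda>N. one_miss_prob N (M N) (q N) (k N)) \<longlonglongrightarrow> exp (- (a * \<Lambda> * exp (- (\<omega> * \<kappa>))))"
proof -
  \<comment> \<open>Limiting probability that a test contains one of the zeros counted by
    \<open>\<omega>\<close>. It is strictly below 1, which makes the comparison of powers uniform in
    the exponent.\<close>
  define Y where "Y = 1 - exp (- (\<omega> * \<kappa>))"
  have Nseq: "filterlim (\<lambda>N::nat. N) at_top sequentially" by (rule filterlim_ident)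
  have N0: "eventually (\<lambda>N::nat. N > 0) sequentially" by (rule eventually_gt_at_top)
  have M0: "eventually (\<lambda>N. M N > 0) sequentially"
    using M eventually_compose_filterlim eventually_gt_at_top by blast
  have q1: "eventually (\<lambda>N. q N \<le> 1) sequentially"
    using order_tendstoD(2)[OF q(1), of 1] by (auto elim: eventually_mono)
  have p1: "p \<le> 1"
    by (rule tendsto_upperbound[OF k(1)])
      (use k(2) in \<open>auto intro!: always_eventually simp: divide_le_eq_1\<close>)
  have \<kappa>: "0 \<le> \<kappa>" by (rule tendsto_lowerbound[OF Nq]) (use q in auto)
  have \<omega>: "0 \<le> \<omega>" unfolding \<omega>_def using p1 by simp
  have Y: "0 \<le> Y" "Y < 1" unfolding Y_def using \<kappa> \<omega> by auto
  have scaled: "(\<lambda>N. real (j N) * q N) \<longlonglongrightarrow> y * \<kappa>"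
    if "(\<lambda>N. real (j N) / real N) \<longlonglongrightarrow> y" for j :: "nat \<Rightarrow> nat" and y
  proof (rule Lim_transform_eventually)
    show "(\<lambda>N. real (j N) / real N * (real N * q N)) \<longlonglongrightarrow> y * \<kappa>" by (intro tendsto_mult that Nq)
    show "eventually (\<lambda>N. real (j N) / real N * (real N * q N) = real (j N) * q N) sequentially"
      using N0 by eventually_elim simp
  qed
  have scaledM: "(\<lambda>N. real (j N) * q N) \<longlonglongrightarrow> y * \<Lambda>"
    if "(\<lambda>N. real (j N) / real (M N)) \<longlonglongrightarrow> y" for j :: "nat \<Rightarrow> nat" and y
  proof (rule Lim_transform_eventually)
    show "(\<lambda>N. real (j N) / real (M N) * (real (M N) * q N)) \<longlonglongrightarrow> y * \<Lambda>" by (intro tendsto_mult that Mq)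
    show "eventually (\<lambda>N. real (j N) / real (M N) * (real (M N) * q N) = real (j N) * q N) sequentially"
      using M0 by eventually_elim simp
  qed
  have pow: "(\<lambda>N. (1 - q N) ^ j N) \<longlonglongrightarrow> exp (- z)"
    if "(\<lambda>N. real (j N) * q N) \<longlonglongrightarrow> z" for j z
    by (rule one_minus_power_tendsto_exp[OF q(1) _ that]) (use q in auto)
  define K where "K = (\<lambda>N v s. binomial_avg (N - k N) ((1 - q N) ^ (v - s)) (\<lambda>w. (1 - (1 - q N) ^ w) ^ s))"
  have K01: "0 \<le> K N v s \<and> K N v s \<le> 1" if "q N \<le> 1" for N v s
    unfolding K_def by (intro binomial_avg_unit_interval) (use q that in \<open>auto simp: power_le_one\<close>)
  \<comment> \<open>Removing \<open>s\<close> tests does not change the limiting ratio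
    \<open>a\<close> when \<open>s\<close> is of smaller order than \<open>M\<close>. The number of
    negative tests is thus typical, and \<open>w\<close> concentrates at
    \<open>\<omega> * N\<close>. The value of \<open>Y ^ s\<close> itself need not converge, hence
    the formulation as a difference.\<close>
  have K_lim: "(\<lambda>N. K N (v N) (s N) - Y ^ s N) \<longlonglongrightarrow> 0"
    if v: "\<And>N. v N \<le> M N" "(\<lambda>N. real (v N) / real (M N)) \<longlonglongrightarrow> a"
      and s: "\<And>N. s N \<le> v N" "(\<lambda>N. real (s N) / real (M N)) \<longlonglongrightarrow> 0" for v s
  proof -
    have vs: "(\<lambda>N. real (v N - s N) / real (M N)) \<longlonglongrightarrow> a"
      using tendsto_diff[OF v(2) s(2)] s(1) by (simp add: of_nat_diff diff_divide_distrib)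
    have Nk: "(\<lambda>N. real (N - k N) / real N) \<longlonglongrightarrow> 1 - p"
    proof (rule Lim_transform_eventually)
      show "(\<lambda>N. 1 - real (k N) / real N) \<longlonglongrightarrow> 1 - p" by (intro tendsto_intros k)
      show "eventually (\<lambda>N. 1 - real (k N) / real N = real (N - k N) / real N) sequentially"
        using N0 by eventually_elim (use k(2) in \<open>simp add: of_nat_diff field_simps\<close>)
    qed
    have "(\<lambda>N. binomial_avg (N - k N) ((1 - q N) ^ (v N - s N))
        (\<lambda>w. (1 - (1 - q N) ^ w) ^ s N - Y ^ s N)) \<longlonglongrightarrow> 0"
    proof (rule binomial_avg_tendsto[where m = "\<lambda>N. N" and B = 1 and y = \<omega>])
      show "eventually (\<lambda>N. 0 \<le> (1 - q N) ^ (v N - s N) \<and> (1 - q N) ^ (v N - s N) \<le> 1) sequentially"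
        using q1 by eventually_elim (use q in \<open>auto simp: power_le_one\<close>)
      show "(\<lambda>N. real (N - k N) * (1 - q N) ^ (v N - s N) / real N) \<longlonglongrightarrow> \<omega>"
        using tendsto_mult[OF Nk pow[OF scaledM[OF vs]]] by (simp add: \<omega>_def)
      show "eventually (\<lambda>N. \<forall>w\<le>N - k N. \<bar>(1 - (1 - q N) ^ w) ^ s N - Y ^ s N\<bar> \<le> 1) sequentially"
        using q1
      proof eventually_elim
        case (elim N)
        show ?case
        proof (intro allI impI)
          fix w
          have "0 \<le> (1 - (1 - q N) ^ w) ^ s N" "(1 - (1 - q N) ^ w) ^ s N \<le> 1" "0 \<le> Y ^ s N" "Y ^ s N \<le> 1"
            using q(2)[of N] elim Y by (auto simp: power_le_one)
          then show "\<bar>(1 - (1 - q N) ^ w) ^ s N - Y ^ s N\<bar> \<le> 1" by linarith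
        qed
      qed
      fix w :: "nat \<Rightarrow> nat" assume "(\<lambda>N. real (w N) / real N) \<longlonglongrightarrow> \<omega>"
      from pow[OF scaled[OF this]] have "(\<lambda>N. 1 - (1 - q N) ^ w N) \<longlonglongrightarrow> Y"
        unfolding Y_def by (intro tendsto_intros)
      then show "(\<lambda>N. (1 - (1 - q N) ^ w N) ^ s N - Y ^ s N) \<longlonglongrightarrow> 0"
      proof (rule power_diff_tendsto_0)
        show "eventually (\<lambda>N. 0 \<le> 1 - (1 - q N) ^ w N) sequentially"
          using q1 by eventually_elim (use q in \<open>auto simp: power_le_one\<close>)
      qed (rule Y)
    qed (auto simp: filterlim_ident)
    then show ?thesis by (simp add: K_def binomial_avg_diff)
  qed
  have eq: "one_miss_prob N (M N) (q N) (k N) =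
      binomial_avg (M N) ((1 - q N) ^ (k N - 1)) (\<lambda>v. binomial_avg v (q N) (K N v))" for N
    by (simp add: one_miss_prob_def K_def)
  show ?thesis
    unfolding eq
  proof (rule binomial_avg_tendsto[where m = M and B = 1 and y = a])
    show x: "eventually (\<lambda>N. 0 \<le> (1 - q N) ^ (k N - 1) \<and> (1 - q N) ^ (k N - 1) \<le> 1) sequentially"
      using q1 by eventually_elim (use q in \<open>auto simp: power_le_one\<close>)
    have "(\<lambda>N. real (k N - 1) * q N) \<longlonglongrightarrow> p * \<kappa>"
    proof (rule Lim_transform_eventually)
      show "(\<lambda>N. real (k N) * q N - q N) \<longlonglongrightarrow> p * \<kappa>"
        using tendsto_diff[OF scaled[OF k(1)] q(1)] by simp
      \<comment> \<open>The subtraction in \<open>k N - 1\<close> is truncated; \<open>p > 0\<close>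
        makes \<open>k N\<close> positive eventually, so that it agrees with the real
        difference.\<close>
      have "eventually (\<lambda>N. real (k N) / real N > 0) sequentially"
        using order_tendstoD(1)[OF k(1) p] .
      then show "eventually (\<lambda>N. real (k N) * q N - q N = real (k N - 1) * q N) sequentially"
      proof eventually_elim
        case (elim N)
        then have "k N > 0" by (cases "k N = 0") auto
        then show ?case by (simp add: of_nat_diff algebra_simps)
      qed
    qed
    from pow[OF this] have "(\<lambda>N. (1 - q N) ^ (k N - 1)) \<longlonglongrightarrow> a" by (simp add: a_def)
    then show "(\<lambda>N. real (M N) * (1 - q N) ^ (k N - 1) / real (M N)) \<longlonglongrightarrow> a"
      by (rule Lim_transform_eventually) (use M0 in \<open>auto elim: eventually_mono\<close>)
    show "eventually (\<lambda>N. \<forall>v\<le>M N. \<bar>binomial_avg v (q N) (K N v)\<bar> \<le> 1) sequentially"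
      using q1
    proof eventually_elim
      case (elim N)
      have "0 \<le> binomial_avg v (q N) (K N v) \<and> binomial_avg v (q N) (K N v) \<le> 1" for v
        by (intro binomial_avg_unit_interval K01) (use q elim in auto)
      then show ?case by simp
    qed
    fix v :: "nat \<Rightarrow> nat" assume v: "\<And>N. v N \<le> M N" "(\<lambda>N. real (v N) / real (M N)) \<longlonglongrightarrow> a"
    \<comment> \<open>\<open>s\<close> has a Poisson limit and does not concentrate; subtracting \<open>Y ^ s\<close>, whose average is
      explicit, leaves a function that vanishes along every admissible sequence.\<close>
    have "(\<lambda>N. binomial_avg (v N) (q N) (\<lambda>s. K N (v N) s - Y ^ s)) \<longlonglongrightarrow> 0"
    proof (rule binomial_avg_tendsto[where m = M and B = 1 and y = 0])
      show "(\<lambda>N. real (v N) * q N / real (M N)) \<longlonglongrightarrow> 0"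
        using tendsto_mult[OF v(2) q(1)] by simp
      show "eventually (\<lambda>N. \<forall>s\<le>v N. \<bar>K N (v N) s - Y ^ s\<bar> \<le> 1) sequentially"
        using q1
      proof eventually_elim
        case (elim N)
        show ?case
        proof (intro allI impI)
          fix s
          have "0 \<le> Y ^ s" "Y ^ s \<le> 1" using Y by (auto simp: power_le_one)
          then show "\<bar>K N (v N) s - Y ^ s\<bar> \<le> 1" using K01[OF elim, of "v N" s] by linarith
        qed
      qed
      show "eventually (\<lambda>N. 0 \<le> q N \<and> q N \<le> 1) sequentially" using q1 q by simp
    qed (use M v K_lim in auto)
    moreover have "(\<lambda>N. (1 - q N * (1 - Y)) ^ v N) \<longlonglongrightarrow> exp (- (a * \<Lambda> * (1 - Y)))"
    proof (rule one_minus_power_tendsto_exp)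
      show "(\<lambda>N. q N * (1 - Y)) \<longlonglongrightarrow> 0" using tendsto_mult_right[OF q(1), of "1 - Y"] by simp
      show "(\<lambda>N. real (v N) * (q N * (1 - Y))) \<longlonglongrightarrow> a * \<Lambda> * (1 - Y)"
        using tendsto_mult_right[OF scaledM[OF v(2)], of "1 - Y"] by (simp add: mult_ac)
    qed (use q Y in auto)
    ultimately have "(\<lambda>N. binomial_avg (v N) (q N) (\<lambda>s. K N (v N) s - Y ^ s) + (1 - q N * (1 - Y)) ^ v N)
       \<longlonglongrightarrow> 0 + exp (- (a * \<Lambda> * (1 - Y)))" by (rule tendsto_add)
    then show "(\<lambda>N. binomial_avg (v N) (q N) (K N (v N))) \<longlonglongrightarrow> exp (- (a * \<Lambda> * exp (- (\<omega> * \<kappa>))))"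
      by (simp add: binomial_avg_diff binomial_avg_power Y_def algebra_simps)
  qed (use M in auto)
qed

text \<open>The limit is \<open>exp 1 + r / d\<close>, where \<open>r\<close> is the limiting
  fraction of variables left for the second stage. In the bound on the excess, \<open>exp 1\<close>
  pays for the zeros, whose limiting survival probability is at most \<open>p * exp 1\<close>, and 1
  for the ones.\<close>

lemma avg_cost_converges:
  assumes p: "0 < p" "p < 1"
  shows "\<exists>l. (\<lambda>N. avg_cost N p) \<longlonglongrightarrow> l \<and> exp 1 \<le> l \<and> l \<le> exp 1 + (exp 1 + 1) / \<bar>ln p\<bar>"
proof -
  define d where "d = p * \<bar>ln p\<bar>"
  define L where "L = real (Ltil p)"
  define M where "M = (\<lambda>N. Mtil N p)"
  define q where "q = (\<lambda>N. L / real (M N))"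
  define \<kappa> where "\<kappa> = L / (exp 1 * d)"
  have lnp: "\<bar>ln p\<bar> > 0" using p by simp
  have d: "d > 0" unfolding d_def using p(1) lnp by (rule mult_pos_pos)
  have L0: "0 \<le> L" unfolding L_def by simp
  have Lle: "L \<le> exp 1 * \<bar>ln p\<bar>" and Lge: "exp 1 * \<bar>ln p\<bar> - 1 \<le> L"
  proof -
    have "0 \<le> exp 1 * \<bar>ln p\<bar>" by simp
    then show "L \<le> exp 1 * \<bar>ln p\<bar>" "exp 1 * \<bar>ln p\<bar> - 1 \<le> L"
      unfolding L_def Ltil_def by linarith+
  qed
  have Mle: "real (M N) \<le> exp 1 * d * real N" and Mge: "exp 1 * d * real N - 1 \<le> real (M N)" for N
  proof -
    have "Mtil N p = nat \<lfloor>exp 1 * d * real N\<rfloor>" by (simp add: Mtil_def d_def mult_ac)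
    moreover have "0 \<le> exp 1 * d * real N" using d by simp
    ultimately show "real (M N) \<le> exp 1 * d * real N" "exp 1 * d * real N - 1 \<le> real (M N)"
      unfolding M_def by linarith+
  qed
  have N0: "eventually (\<lambda>N::nat. N > 0) sequentially" by (rule eventually_gt_at_top)
  have MN: "(\<lambda>N. real (M N) / real N) \<longlonglongrightarrow> exp 1 * d"
  proof (rule real_tendsto_sandwich)
    show "(\<lambda>N. exp 1 * d - 1 / real N) \<longlonglongrightarrow> exp 1 * d" by real_asymp
    show "eventually (\<lambda>N. exp 1 * d - 1 / real N \<le> real (M N) / real N) sequentially"
      using N0
    proof eventually_elim
      case (elim N)
      have "(exp 1 * d * real N - 1) / real N \<le> real (M N) / real N"
        using Mge by (rule divide_right_mono) simp
      then show ?case using elim by (simp add: diff_divide_distrib)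
    qed
    show "eventually (\<lambda>N. real (M N) / real N \<le> exp 1 * d) sequentially"
      using N0 by eventually_elim (use Mle in \<open>simp add: divide_le_eq\<close>)
  qed auto
  have Mr: "filterlim (\<lambda>N. real (M N)) at_top sequentially"
  proof (rule filterlim_at_top_mono)
    show "filterlim (\<lambda>N. exp 1 * d * real N - 1) at_top sequentially" using d by real_asymp
  qed (use Mge in auto)
  then have M: "filterlim M at_top sequentially"
    by (simp add: filterlim_sequentially_iff_filterlim_real)
  have M0: "eventually (\<lambda>N. M N > 0) sequentially"
    using M eventually_compose_filterlim eventually_gt_at_top by blast
  have q: "q \<longlonglongrightarrow> 0" "\<And>N. 0 \<le> q N"
  proof -
    show "q \<longlonglongrightarrow> 0" unfolding q_def
      by (rule tendsto_divide_0[OF tendsto_const]) (rule filterlim_at_top_imp_at_infinity[OF Mr])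
    show "0 \<le> q N" for N using L0 by (simp add: q_def)
  qed
  have q1: "eventually (\<lambda>N. q N \<le> 1) sequentially"
    using order_tendstoD(2)[OF q(1), of 1] by (auto elim: eventually_mono)
  have Mq: "(\<lambda>N. real (M N) * q N) \<longlonglongrightarrow> L"
  proof (rule Lim_transform_eventually[OF tendsto_const])
    show "eventually (\<lambda>N. L = real (M N) * q N) sequentially"
      using M0 by eventually_elim (simp add: q_def)
  qed
  have Nq: "(\<lambda>N. real N * q N) \<longlonglongrightarrow> \<kappa>"
  proof (rule Lim_transform_eventually)
    show "(\<lambda>N. L / (real (M N) / real N)) \<longlonglongrightarrow> \<kappa>"
      unfolding \<kappa>_def by (intro tendsto_divide tendsto_const MN) (use d in auto)
  qed (auto simp: q_def mult_ac)
  define a where "a = exp (- (p * \<kappa>))"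
  define H where "H = exp (- (a * L * exp (- ((1 - p) * exp (- (a * L)) * \<kappa>))))"
  define r where "r = (1 - p) * exp (- (a * L)) + p * H"
  define F where "F = (\<lambda>N k. (real (N - k) * (1 - q N * (1 - q N) ^ k) ^ M N
      + real k * one_miss_prob N (M N) (q N) k) / real N)"
  have F: "(\<lambda>N. binomial_avg N p (F N)) \<longlonglongrightarrow> r"
  proof (rule binomial_avg_tendsto[where m = "\<lambda>N. N" and B = 1 and y = p])
    show "(\<lambda>N. real N * p / real N) \<longlonglongrightarrow> p"
    proof (rule Lim_transform_eventually[OF tendsto_const])
      show "eventually (\<lambda>N. p = real N * p / real N) sequentially"
        using N0 by eventually_elim simp
    qed
    show "eventually (\<lambda>N. \<forall>k\<le>N. \<bar>F N k\<bar> \<le> 1) sequentially"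
      using q1 N0
    proof eventually_elim
      case (elim N)
      show ?case
      proof (intro allI impI)
        fix k assume k: "k \<le> N"
        let ?h = "(1 - q N * (1 - q N) ^ k) ^ M N" and ?g = "one_miss_prob N (M N) (q N) k"
        have "0 \<le> q N * (1 - q N) ^ k" "q N * (1 - q N) ^ k \<le> 1"
          using q elim by (auto intro!: mult_le_one simp: power_le_one)
        then have h: "0 \<le> ?h" "?h \<le> 1" by (auto simp: power_le_one)
        have g: "0 \<le> ?g" "?g \<le> 1" using one_miss_prob_unit_interval[of "q N"] q elim by auto
        have "real (N - k) * ?h + real k * ?g \<le> real (N - k) * 1 + real k * 1"
          by (intro add_mono mult_left_mono) (use h g in auto)
        also have "\<dots> = real N" using k by simp
        finally have "F N k \<le> 1" unfolding F_def using elim by (simp add: divide_le_eq)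
        moreover have "0 \<le> F N k" unfolding F_def using h g by simp
        ultimately show "\<bar>F N k\<bar> \<le> 1" by simp
      qed
    qed
    fix k :: "nat \<Rightarrow> nat" assume k: "\<And>N. k N \<le> N" "(\<lambda>N. real (k N) / real N) \<longlonglongrightarrow> p"
    have G: "(\<lambda>N. one_miss_prob N (M N) (q N) (k N)) \<longlonglongrightarrow> H"
      unfolding H_def a_def by (rule one_miss_prob_tendsto[OF M q Mq Nq k(2,1) p(1)])
    have kq: "(\<lambda>N. real (k N) * q N) \<longlonglongrightarrow> p * \<kappa>"
    proof (rule Lim_transform_eventually)
      show "(\<lambda>N. real (k N) / real N * (real N * q N)) \<longlonglongrightarrow> p * \<kappa>" by (intro tendsto_mult k Nq)
      show "eventually (\<lambda>N. real (k N) / real N * (real N * q N) = real (k N) * q N) sequentially"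
        using N0 by eventually_elim simp
    qed
    have a: "(\<lambda>N. (1 - q N) ^ k N) \<longlonglongrightarrow> a" unfolding a_def
      by (rule one_minus_power_tendsto_exp[OF q(1) _ kq]) (use q in auto)
    have h: "(\<lambda>N. (1 - q N * (1 - q N) ^ k N) ^ M N) \<longlonglongrightarrow> exp (- (a * L))"
    proof (rule one_minus_power_tendsto_exp)
      show "(\<lambda>N. q N * (1 - q N) ^ k N) \<longlonglongrightarrow> 0" using tendsto_mult[OF q(1) a] by simp
      show "eventually (\<lambda>N. 0 \<le> q N * (1 - q N) ^ k N) sequentially"
        using q1 by eventually_elim (use q in auto)
      show "(\<lambda>N. real (M N) * (q N * (1 - q N) ^ k N)) \<longlonglongrightarrow> a * L"
        using tendsto_mult[OF a Mq] by (simp add: mult_ac)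
    qed
    show "(\<lambda>N. F N (k N)) \<longlonglongrightarrow> r"
    proof (rule Lim_transform_eventually)
      show "(\<lambda>N. (1 - real (k N) / real N) * (1 - q N * (1 - q N) ^ k N) ^ M N
         + real (k N) / real N * one_miss_prob N (M N) (q N) (k N)) \<longlonglongrightarrow> r"
        unfolding r_def by (intro tendsto_intros k h G)
      show "eventually (\<lambda>N. (1 - real (k N) / real N) * (1 - q N * (1 - q N) ^ k N) ^ M N
         + real (k N) / real N * one_miss_prob N (M N) (q N) (k N) = F N (k N)) sequentially"
        using N0
      proof eventually_elim
        case (elim N)
        then have "1 - real (k N) / real N = real (N - k N) / real N"
          using k(1)[of N] by (simp add: of_nat_diff field_simps)
        then show ?case unfolding F_def by (simp add: add_divide_distrib)
      qed
    qed
  qed (use p in \<open>auto simp: filterlim_ident\<close>)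
  have "(\<lambda>N. real (M N) / real N / d + binomial_avg N p (F N) / d) \<longlonglongrightarrow> exp 1 * d / d + r / d"
    using d by (intro tendsto_intros MN F) auto
  moreover have "avg_cost N p = real (M N) / real N / d + binomial_avg N p (F N) / d" for N
  proof -
    have "avg_cost N p = (real (M N) + binomial_avg N p (\<lambda>k. real (N - k) * (1 - q N * (1 - q N) ^ k) ^ M N
      + real k * one_miss_prob N (M N) (q N) k)) / (real N * d)"
      unfolding d_def M_def q_def L_def avg_cost_eq mult.assoc ..
    then show ?thesis unfolding F_def binomial_avg_divide by (simp add: add_divide_distrib)
  qed
  ultimately have lim: "(\<lambda>N. avg_cost N p) \<longlonglongrightarrow> exp 1 + r / d" using d by simp
  \<comment> \<open>The integer part can only lower \<open>L\<close>, so a test has at most one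
    member among the ones on average and is free of ones with limiting probability \<open>a\<close>
    at least 1/e.\<close>
  have "p * \<kappa> = L / (exp 1 * \<bar>ln p\<bar>)" unfolding \<kappa>_def d_def using p by simp
  also have "\<dots> \<le> 1" using Lle lnp by (simp add: divide_le_eq)
  finally have "exp (- 1) \<le> a" unfolding a_def by simp
  \<comment> \<open>Losing at most 1 in \<open>L\<close> lowers the exponent by at most
    \<open>exp (- 1)\<close>, rounded up to 1 below; this is the origin of the factor
    \<open>exp 1\<close> in the bound on the survival of zeros.\<close>
  then have "exp (- 1) * (exp 1 * \<bar>ln p\<bar> - 1) \<le> a * L"
    using Lge L0 by (meson mult_mono exp_ge_zero order.trans mult_left_mono mult_right_mono)
  moreover have "exp (- 1) * (exp 1 * \<bar>ln p\<bar> - 1) = - ln p - exp (- 1)"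
    using p by (simp add: exp_minus field_simps)
  moreover have "exp (- 1 :: real) \<le> 1" by simp
  ultimately have "- (a * L) \<le> ln p + 1" by linarith
  then have "exp (- (a * L)) \<le> exp (ln p + 1)" by simp
  also have "\<dots> = p * exp 1" using p by (simp add: exp_add)
  finally have aL: "exp (- (a * L)) \<le> p * exp 1" .
  have "(1 - p) * exp (- (a * L)) \<le> 1 * (p * exp 1)" using p aL by (intro mult_mono) auto
  moreover have "p * H \<le> p * 1" using p L0 unfolding H_def a_def by (intro mult_left_mono) auto
  ultimately have "r \<le> p * (exp 1 + 1)" unfolding r_def by (simp add: algebra_simps)
  then have "r / d \<le> p * (exp 1 + 1) / d" using d by (intro divide_right_mono) auto
  also have "\<dots> = (exp 1 + 1) / \<bar>ln p\<bar>" unfolding d_def using p by simp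
  finally have "r / d \<le> (exp 1 + 1) / \<bar>ln p\<bar>" .
  moreover have "0 \<le> r / d" unfolding r_def H_def using p d by simp
  ultimately show ?thesis using lim by (intro exI[of _ "exp 1 + r / d"]) auto
qed

section \<open>The limit for p = N powr (-\<beta>)\<close>

text \<open>
  The second term is a Chernoff bound for more than \<open>(1 + \<delta>) N p\<close> ones, with exponential
  parameter \<open>\<delta> / 2\<close>; Chebyshev's inequality would be too weak for \<open>\<beta> \<ge> 1/2\<close>.
\<close>
lemma avg_not_sure_zero_le:
  assumes p: "0 < p" "p < 1" and q: "0 \<le> q" "q \<le> 1/2" and \<delta>: "0 \<le> \<delta>" "\<delta> \<le> 1"
  shows "binomial_avg N p (\<lambda>k. (1 - q * (1 - q) ^ k) ^ M) \<le>
    exp (- (real M * q * exp (- ((q + 2 * q\<^sup>2) * ((1 + \<delta>) * (real N * p)))))) + exp (- (real N * p * \<delta>\<^sup>2 / 4))"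
proof -
  define t where "t = (1 + \<delta>) * (real N * p)"
  define \<theta> where "\<theta> = \<delta> / 2"
  define G where "G = exp (- (real M * q * exp (- ((q + 2 * q\<^sup>2) * t))))"
  have \<theta>: "0 \<le> \<theta>" "\<theta> \<le> 1" using \<delta> by (auto simp: \<theta>_def)
  \<comment> \<open>Up to the threshold \<open>t\<close> monotonicity in \<open>k\<close> gives the
    bound \<open>G\<close>. Beyond it the survival probability is at most 1, which is dominated by
    exp (\<theta> (k - t)).\<close>
  have "binomial_avg N p (\<lambda>k. (1 - q * (1 - q) ^ k) ^ M) \<le> binomial_avg N p (\<lambda>k. G + exp (- (\<theta> * t)) * exp \<theta> ^ k)"
  proof (rule binomial_avg_mono)
    fix k assume "k \<le> N"
    have u: "0 \<le> q * (1 - q) ^ k" "q * (1 - q) ^ k \<le> 1"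
      using q by (auto intro!: mult_le_one simp: power_le_one)
    have e: "exp (- (\<theta> * t)) * exp \<theta> ^ k = exp (\<theta> * (real k - t))"
      by (simp add: exp_of_nat_mult[symmetric] exp_add[symmetric] algebra_simps)
    show "(1 - q * (1 - q) ^ k) ^ M \<le> G + exp (- (\<theta> * t)) * exp \<theta> ^ k"
    proof (cases "real k \<le> t")
      case True
      have "(q + 2 * q\<^sup>2) * real k \<le> (q + 2 * q\<^sup>2) * t" using True q by (intro mult_left_mono) auto
      then have "exp (- ((q + 2 * q\<^sup>2) * t)) \<le> exp (real k * (- q - 2 * q\<^sup>2))"
        by (simp add: algebra_simps)
      also have "\<dots> \<le> exp (real k * ln (1 - q))"
        using ln_one_minus_pos_lower_bound[OF q] by (simp add: mult_left_mono)
      also have "\<dots> = (1 - q) ^ k" using q by (simp add: exp_of_nat_mult)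
      finally have "real M * q * exp (- ((q + 2 * q\<^sup>2) * t)) \<le> real M * q * (1 - q) ^ k"
        using q by (intro mult_left_mono) auto
      then have "exp (- (real M * q * (1 - q) ^ k)) \<le> G" unfolding G_def by simp
      moreover have "(1 - q * (1 - q) ^ k) ^ M \<le> exp (- (q * (1 - q) ^ k)) ^ M"
        using exp_ge_add_one_self[of "- (q * (1 - q) ^ k)"] u by (intro power_mono) auto
      moreover have "exp (- (q * (1 - q) ^ k)) ^ M = exp (- (real M * q * (1 - q) ^ k))"
        by (simp add: exp_of_nat_mult[symmetric] mult.assoc)
      moreover have "0 \<le> exp (- (\<theta> * t)) * exp \<theta> ^ k" by simp
      ultimately show ?thesis by linarith
    next
      case False
      then have "1 \<le> exp (\<theta> * (real k - t))" using \<theta> by simp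
      moreover have "(1 - q * (1 - q) ^ k) ^ M \<le> 1" using u by (simp add: power_le_one)
      moreover have "0 \<le> G" unfolding G_def by simp
      ultimately show ?thesis unfolding e by linarith
    qed
  qed (use p in auto)
  also have "\<dots> = G + exp (- (\<theta> * t)) * (1 + p * (exp \<theta> - 1)) ^ N"
    unfolding binomial_avg_add binomial_avg_mult binomial_avg_power by (simp add: algebra_simps)
  also have "(1 + p * (exp \<theta> - 1)) ^ N \<le> exp (p * (exp \<theta> - 1)) ^ N"
    using exp_ge_add_one_self[of "p * (exp \<theta> - 1)"] p \<theta> by (intro power_mono) auto
  also have "\<dots> = exp (real N * p * (exp \<theta> - 1))"
    by (simp add: exp_of_nat_mult[symmetric] mult.assoc)
  \<comment> \<open>Together with - \<theta> t this leaves the exponent N p (\<theta>^2 - \<delta>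
    \<theta>), which is minimal at \<theta> = \<delta> / 2 with value - N p \<delta>^2 / 4.\<close>
  also have "\<dots> \<le> exp (real N * p * (\<theta> + \<theta>\<^sup>2))"
    using exp_bound[OF \<theta>] p by (simp add: mult_left_mono)
  finally have "binomial_avg N p (\<lambda>k. (1 - q * (1 - q) ^ k) ^ M) \<le>
     G + exp (- (\<theta> * t)) * exp (real N * p * (\<theta> + \<theta>\<^sup>2))" by simp
  also have "exp (- (\<theta> * t)) * exp (real N * p * (\<theta> + \<theta>\<^sup>2)) = exp (- (real N * p * \<delta>\<^sup>2 / 4))"
    unfolding exp_add[symmetric] t_def \<theta>_def by (simp add: field_simps power2_eq_square)
  finally show ?thesis unfolding G_def t_def .
qed

text \<open>The lower bound keeps the first stage only. For the upper bound there are at most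
  \<open>N\<close> zeros, and every one is charged a full second-stage test; their mean number N p
  gives the term \<open>1 / l\<close>.\<close>

lemma avg_cost_bounds:
  fixes N :: nat and p :: real
  defines "M \<equiv> Mtil N p" and "l \<equiv> \<bar>ln p\<bar>"
  defines "q \<equiv> real (Ltil p) / real M"
  assumes N: "N > 0" and p: "0 < p" "p < 1" and M: "M > 0" and q: "q \<le> 1/2" and \<delta>: "0 \<le> \<delta>" "\<delta> \<le> 1"
  shows "real M / (real N * p * l) \<le> avg_cost N p"
    and "avg_cost N p \<le> real M / (real N * p * l) +
      (exp (- (real (Ltil p) * exp (- ((q + 2 * q\<^sup>2) * ((1 + \<delta>) * (real N * p))))))
       + exp (- (real N * p * \<delta>\<^sup>2 / 4))) / (p * l) + 1 / l"
proof -
  have q0: "0 \<le> q" unfolding q_def by simp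
  have l: "l > 0" unfolding l_def using p by simp
  have c: "real N * p * l > 0" using N p l by simp
  define h where "h = (\<lambda>k. (1 - q * (1 - q) ^ k) ^ M)"
  define g where "g = one_miss_prob N M q"
  have h: "0 \<le> h k" for k
  proof -
    have "q * (1 - q) ^ k \<le> 1" using q q0 by (intro mult_le_one) (auto simp: power_le_one)
    then show ?thesis unfolding h_def by simp
  qed
  have g: "0 \<le> g k" "g k \<le> 1" for k
    using one_miss_prob_unit_interval[of q N M k] q q0 by (auto simp: g_def)
  have eq: "avg_cost N p = (real M + binomial_avg N p (\<lambda>k. real (N - k) * h k + real k * g k)) / (real N * p * l)"
    unfolding avg_cost_eq h_def g_def M_def q_def l_def ..
  have "0 \<le> binomial_avg N p (\<lambda>k. real (N - k) * h k + real k * g k)"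
    using binomial_avg_mono[of p N "\<lambda>_. 0" "\<lambda>k. real (N - k) * h k + real k * g k"] p h g by simp
  then show "real M / (real N * p * l) \<le> avg_cost N p"
    unfolding eq using c by (intro divide_right_mono) auto
  have "binomial_avg N p (\<lambda>k. real (N - k) * h k + real k * g k) \<le> binomial_avg N p (\<lambda>k. real N * h k + real k)"
    by (intro binomial_avg_mono add_mono mult_right_mono) (use p h g in \<open>auto simp: mult_left_le\<close>)
  also have "\<dots> = real N * binomial_avg N p h + real N * p"
    by (simp add: binomial_avg_add binomial_avg_mult binomial_avg_mean)
  finally have "avg_cost N p \<le> (real M + (real N * binomial_avg N p h + real N * p)) / (real N * p * l)"
    unfolding eq using c by (intro divide_right_mono) auto
  also have "\<dots> = real M / (real N * p * l) + binomial_avg N p h / (p * l) + 1 / l"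
    using N p l by (simp add: field_simps)
  also have "binomial_avg N p h / (p * l) \<le>
      (exp (- (real (Ltil p) * exp (- ((q + 2 * q\<^sup>2) * ((1 + \<delta>) * (real N * p))))))
       + exp (- (real N * p * \<delta>\<^sup>2 / 4))) / (p * l)"
  proof (rule divide_right_mono)
    have "real M * q = real (Ltil p)" using M by (simp add: q_def)
    then show "binomial_avg N p h \<le> exp (- (real (Ltil p) * exp (- ((q + 2 * q\<^sup>2) * ((1 + \<delta>) * (real N * p))))))
       + exp (- (real N * p * \<delta>\<^sup>2 / 4))"
      using avg_not_sure_zero_le[OF p q0 q \<delta>, of N M] by (simp add: h_def)
  qed (use p l in auto)
  finally show "avg_cost N p \<le> real M / (real N * p * l) +
      (exp (- (real (Ltil p) * exp (- ((q + 2 * q\<^sup>2) * ((1 + \<delta>) * (real N * p))))))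
       + exp (- (real N * p * \<delta>\<^sup>2 / 4))) / (p * l) + 1 / l" by simp
qed

lemma avg_cost_powr_tendsto:
  assumes \<beta>: "0 < \<beta>" "\<beta> < 1"
  shows "(\<lambda>N. avg_cost N (real N powr (- \<beta>))) \<longlonglongrightarrow> exp 1"
proof -
  define p where "p = (\<lambda>N::nat. real N powr (- \<beta>))"
  define l where "l = (\<lambda>N::nat. \<beta> * ln (real N))"
  define n where "n = (\<lambda>N::nat. real N powr (1 - \<beta>))"
  \<comment> \<open>The largest order allowed: \<open>\<delta> N * l N\<close> equals
    \<open>\<beta>\<close>, so the wider window costs only a bounded factor.\<close>
  define \<delta> where "\<delta> = (\<lambda>N::nat. 1 / ln (real N))"
  \<comment> \<open>An upper bound for \<open>q\<close> with the integer parts removed: the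
    numerator of L / M is at most e l and the denominator at least e n l - 1.\<close>
  define q' where "q' = (\<lambda>N. exp 1 * l N / (exp 1 * n N * l N - 1))"
  \<comment> \<open>The relative excess in the exponent: the lower estimate of
    \<open>(1 - q) ^ k\<close> at the edge of the window becomes
    \<open>exp (- (1 + \<epsilon> N))\<close>, to be compared with 1/e.\<close>
  define \<epsilon> where "\<epsilon> = (\<lambda>N. (q' N + 2 * (q' N)\<^sup>2) * ((1 + \<delta> N) * n N) - 1)"
  define R where "R = (\<lambda>N. exp (\<epsilon> N * l N + (1 - \<epsilon> N) / exp 1) / l N +
     exp (- (n N * (\<delta> N)\<^sup>2 / 4)) / (p N * l N) + 1 / l N)"
  have l_lim: "filterlim l at_top sequentially" unfolding l_def using \<beta> by real_asymp
  \<comment> \<open>Since q' n = 1 + r with r l vanishing, the only part of \<epsilon> l that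
    survives is \<delta> l = \<beta>. Knowing that \<epsilon> tends to 0 would not suffice, because
    it is multiplied by l inside an exponential.\<close>
  have R1: "(\<lambda>N. \<epsilon> N * l N) \<longlonglongrightarrow> \<beta>"
  proof (rule Lim_transform_eventually)
    define r where "r = (\<lambda>N. 1 / (exp 1 * n N * l N - 1))"
    have "r \<longlonglongrightarrow> 0" "(\<lambda>N. r N * l N) \<longlonglongrightarrow> 0" "\<delta> \<longlonglongrightarrow> 0" "(\<lambda>N. q' N * l N) \<longlonglongrightarrow> 0"
      unfolding r_def q'_def \<delta>_def n_def l_def using \<beta> by real_asymp+
    then have "(\<lambda>N. \<beta> + r N * l N * (1 + \<delta> N) + 2 * (q' N * l N) * ((1 + r N) * (1 + \<delta> N)))
        \<longlonglongrightarrow> \<beta> + 0 * (1 + 0) + 2 * 0 * ((1 + 0) * (1 + 0))"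
      by (intro tendsto_intros)
    then show "(\<lambda>N. \<beta> + r N * l N * (1 + \<delta> N) + 2 * (q' N * l N) * ((1 + r N) * (1 + \<delta> N))) \<longlonglongrightarrow> \<beta>"
      by simp
    have "eventually (\<lambda>N. exp 1 * n N * l N - 1 \<noteq> 0 \<and> l N \<noteq> 0) sequentially"
    proof -
      have "eventually (\<lambda>N. exp 1 * n N * l N - 1 > 0) sequentially" "eventually (\<lambda>N. l N > 0) sequentially"
        unfolding n_def l_def using \<beta> by real_asymp+
      then show ?thesis by eventually_elim simp
    qed
    then show "eventually (\<lambda>N. \<beta> + r N * l N * (1 + \<delta> N) + 2 * (q' N * l N) * ((1 + r N) * (1 + \<delta> N))
        = \<epsilon> N * l N) sequentially"
    proof eventually_elim
      case (elim N)
      have qn: "q' N * n N = 1 + r N" unfolding q'_def r_def using elim by (simp add: field_simps)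
      have dl: "\<delta> N * l N = \<beta>" unfolding \<delta>_def l_def using elim by (auto simp: l_def)
      have "\<epsilon> N * l N = (q' N * n N * (1 + \<delta> N) + 2 * q' N * (q' N * n N) * (1 + \<delta> N) - 1) * l N"
        unfolding \<epsilon>_def by (simp add: power2_eq_square algebra_simps)
      also have "\<dots> = \<delta> N * l N + r N * l N * (1 + \<delta> N) + 2 * (q' N * l N) * ((1 + r N) * (1 + \<delta> N))"
        unfolding qn by (simp add: algebra_simps)
      finally show ?case unfolding dl by simp
    qed
  qed
  have R2: "\<epsilon> \<longlonglongrightarrow> 0"
  proof (rule Lim_transform_eventually)
    show "(\<lambda>N. \<epsilon> N * l N / l N) \<longlonglongrightarrow> 0"
      by (rule tendsto_divide_0[OF R1]) (rule filterlim_at_top_imp_at_infinity[OF l_lim])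
    have "eventually (\<lambda>N. l N > 0) sequentially" unfolding l_def using \<beta> by real_asymp
    then show "eventually (\<lambda>N. \<epsilon> N * l N / l N = \<epsilon> N) sequentially" by eventually_elim simp
  qed
  \<comment> \<open>Here \<beta> < 1 enters: n \<delta>^2 is a positive power of N over a squared
    logarithm, so the exponential beats the polynomial factor 1 / p.\<close>
  have R3: "(\<lambda>N. exp (- (n N * (\<delta> N)\<^sup>2 / 4)) / (p N * l N)) \<longlonglongrightarrow> 0"
    unfolding p_def \<delta>_def n_def l_def using \<beta> by real_asymp
  have R: "R \<longlonglongrightarrow> 0"
  proof -
    have "(\<lambda>N. exp (\<epsilon> N * l N + (1 - \<epsilon> N) / exp 1)) \<longlonglongrightarrow> exp (\<beta> + (1 - 0) / exp 1)"
      by (intro tendsto_intros R1 R2) simp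
    then have "(\<lambda>N. exp (\<epsilon> N * l N + (1 - \<epsilon> N) / exp 1) / l N) \<longlonglongrightarrow> 0"
      by (rule tendsto_divide_0) (rule filterlim_at_top_imp_at_infinity[OF l_lim])
    moreover have "(\<lambda>N. 1 / l N) \<longlonglongrightarrow> 0"
      by (rule tendsto_divide_0[OF tendsto_const]) (rule filterlim_at_top_imp_at_infinity[OF l_lim])
    ultimately show ?thesis unfolding R_def using R3 by (auto intro!: tendsto_add_zero)
  qed
  have ev: "eventually (\<lambda>N::nat. N \<ge> 3) sequentially"
    "eventually (\<lambda>N. l N \<ge> 1) sequentially"
    "eventually (\<lambda>N. exp 1 * n N * l N - 1 \<ge> 1) sequentially"
    "eventually (\<lambda>N. q' N \<le> 1/2) sequentially"
    unfolding q'_def n_def l_def using \<beta>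
    by (auto intro: eventually_ge_at_top) (real_asymp+)
  have main: "eventually (\<lambda>N. exp 1 - 1 / (n N * l N) \<le> avg_cost N (p N) \<and> avg_cost N (p N) \<le> exp 1 + R N) sequentially"
    using ev
  proof eventually_elim
    case (elim N)
    have lnN: "ln (real N) \<ge> 1"
    proof -
      have "exp 1 \<le> (3::real)" by (rule exp_le)
      then have "exp 1 \<le> real N" using elim by linarith
      then show ?thesis using elim by (subst ln_ge_iff) auto
    qed
    have p: "0 < p N" "p N < 1" unfolding p_def using elim \<beta> by (auto simp: powr_less_one)
    have lp: "\<bar>ln (p N)\<bar> = l N" unfolding p_def l_def using elim \<beta> lnN by (simp add: ln_powr abs_mult)
    have Np: "real N * p N = n N"
      using powr_add[of "real N" 1 "- \<beta>"] elim by (simp add: p_def n_def)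
    have n0: "n N > 0" unfolding n_def using elim by simp
    let ?M = "Mtil N (p N)" and ?L = "real (Ltil (p N))"
    have Meq: "?M = nat \<lfloor>exp 1 * n N * l N\<rfloor>" unfolding Mtil_def lp Np[symmetric] by (simp add: mult.assoc)
    have Mle: "real ?M \<le> exp 1 * n N * l N" and Mge: "exp 1 * n N * l N - 1 \<le> real ?M"
      unfolding Meq using elim by linarith+
    have M0: "?M > 0" using Mge elim by (cases "?M = 0") auto
    have el: "exp 1 * l N \<ge> 1"
    proof -
      have "1 * 1 \<le> exp (1::real) * l N" using elim by (intro mult_mono) auto
      then show ?thesis by simp
    qed
    have Lle: "?L \<le> exp 1 * l N" and Lge: "exp 1 * l N - 1 \<le> ?L"
      unfolding Ltil_def lp using el by linarith+
    define q where "q = ?L / real ?M"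
    have q0: "0 \<le> q" unfolding q_def by simp
    have qq: "q \<le> q' N" unfolding q_def q'_def using Lle Mge elim by (intro frac_le) auto
    have \<delta>: "0 \<le> \<delta> N" "\<delta> N \<le> 1" unfolding \<delta>_def using lnN by auto
    have qh: "?L / real ?M \<le> 1/2" using qq elim unfolding q_def by linarith
    note B = avg_cost_bounds[OF _ p M0 qh \<delta>, unfolded lp Np q_def[symmetric]]
    have c0: "n N * l N > 0" using n0 elim by simp
    have "(exp 1 * n N * l N - 1) / (n N * l N) \<le> real ?M / (n N * l N)"
      using Mge c0 by (intro divide_right_mono) auto
    moreover have "(exp 1 * n N * l N - 1) / (n N * l N) = exp 1 - 1 / (n N * l N)"
      using n0 elim by (simp add: field_simps)
    ultimately have lower: "exp 1 - 1 / (n N * l N) \<le> avg_cost N (p N)"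
      using B(1) elim by linarith
    have "real ?M / (n N * l N) \<le> exp 1 * n N * l N / (n N * l N)"
      using Mle c0 by (intro divide_right_mono) auto
    then have Mup: "real ?M / (n N * l N) \<le> exp 1" using n0 elim by simp
    have "(q + 2 * q\<^sup>2) * ((1 + \<delta> N) * n N) \<le> (q' N + 2 * (q' N)\<^sup>2) * ((1 + \<delta> N) * n N)"
      using q0 qq \<delta> n0 by (intro mult_right_mono add_mono mult_left_mono power_mono) auto
    then have "exp (- (1 + \<epsilon> N)) \<le> exp (- ((q + 2 * q\<^sup>2) * ((1 + \<delta> N) * n N)))"
      unfolding \<epsilon>_def by simp
    moreover have "exp (- 1) * (1 - \<epsilon> N) \<le> exp (- (1 + \<epsilon> N))"
      using exp_ge_add_one_self[of "- \<epsilon> N"] by (simp add: exp_add[of "- 1" "- \<epsilon> N", simplified])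
    ultimately have X: "exp (- 1) * (1 - \<epsilon> N) \<le> exp (- ((q + 2 * q\<^sup>2) * ((1 + \<delta> N) * n N)))" (is "_ \<le> ?X")
      by linarith
    \<comment> \<open>Splits off the main term l, for which exp (- l) = p cancels the p in the
      denominator. The term (1 - \<epsilon>) / e is the loss from the integer part in L.\<close>
    have "l N - (\<epsilon> N * l N + (1 - \<epsilon> N) / exp 1) = (exp 1 * l N - 1) * (exp (- 1) * (1 - \<epsilon> N))"
      by (simp add: exp_minus field_simps)
    also have "\<dots> \<le> (exp 1 * l N - 1) * ?X" using X el by (intro mult_left_mono) auto
    also have "\<dots> \<le> ?L * ?X" using Lge by (intro mult_right_mono) auto
    finally have "exp (- (?L * ?X)) \<le> exp (\<epsilon> N * l N + (1 - \<epsilon> N) / exp 1 - l N)" by simp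
    also have "\<dots> = exp (\<epsilon> N * l N + (1 - \<epsilon> N) / exp 1) * p N"
    proof -
      have "ln (p N) = - l N" using lp p by (simp add: ln_less_zero abs_if split: if_splits)
      then have "exp (- l N) = p N" using p by (metis exp_ln)
      then show ?thesis by (simp add: exp_diff exp_minus divide_inverse)
    qed
    finally have "exp (- (?L * ?X)) / (p N * l N) \<le> exp (\<epsilon> N * l N + (1 - \<epsilon> N) / exp 1) * p N / (p N * l N)"
      using p elim by (intro divide_right_mono) auto
    then have "exp (- (?L * ?X)) / (p N * l N) \<le> exp (\<epsilon> N * l N + (1 - \<epsilon> N) / exp 1) / l N"
      using p by simp
    then have "avg_cost N (p N) \<le> exp 1 + R N"
      using B(2) Mup elim unfolding R_def add_divide_distrib by linarith
    with lower show ?case by simp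
  qed
  have "(\<lambda>N. avg_cost N (p N)) \<longlonglongrightarrow> exp 1"
  proof (rule real_tendsto_sandwich)
    show "(\<lambda>N. exp 1 - 1 / (n N * l N)) \<longlonglongrightarrow> exp 1" unfolding n_def l_def using \<beta> by real_asymp
    show "(\<lambda>N. exp 1 + R N) \<longlonglongrightarrow> exp 1" using tendsto_add[OF tendsto_const R] by simp
  qed (use main in \<open>auto elim: eventually_mono\<close>)
  then show ?thesis unfolding p_def .
qed

text \<open>For \<beta> = 0 the iterated limit is expressed by a function \<open>g\<close>
  collecting the inner limits. It is required to exist for all small positive \<open>p\<close>,
  where uniqueness of limits determines it.\<close>

theorem theorem5:
  fixes \<beta> :: real
  assumes "0 \<le> \<beta>" and "\<beta> < 1"
  shows "(\<beta> > 0 \<longrightarrow> (\<lambda>N. avg_cost N (real N powr (-\<beta>))) \<longlonglongrightarrow> exp 1) \<and>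
         (\<beta> = 0 \<longrightarrow> (\<exists>g. (\<forall>\<^sub>F p in at_right 0. (\<lambda>N. avg_cost N p) \<longlonglongrightarrow> g p) \<and>
                          (g \<longlongrightarrow> exp 1) (at_right 0)))"
proof (intro conjI impI)
  show "(\<lambda>N. avg_cost N (real N powr (-\<beta>))) \<longlonglongrightarrow> exp 1" if "\<beta> > 0"
    using avg_cost_powr_tendsto that assms by blast
  \<comment> \<open>Placing the range of \<open>p\<close> inside the existential makes the claim
    vacuous elsewhere, so that choice yields a total function \<open>g\<close>.\<close>
  have "\<forall>p. \<exists>l. 0 < p \<and> p < 1 \<longrightarrow> (\<lambda>N. avg_cost N p) \<longlonglongrightarrow> l \<and> exp 1 \<le> l
      \<and> l \<le> exp 1 + (exp 1 + 1) / \<bar>ln p\<bar>"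
    using avg_cost_converges by blast
  then obtain g where g: "(\<lambda>N. avg_cost N p) \<longlonglongrightarrow> g p" "exp 1 \<le> g p" "g p \<le> exp 1 + (exp 1 + 1) / \<bar>ln p\<bar>"
    if "0 < p" "p < 1" for p
    by metis
  have ev: "eventually (\<lambda>p::real. 0 < p \<and> p < 1) (at_right 0)"
    unfolding eventually_at_right_field by (intro exI[of _ 1]) auto
  have "(g \<longlongrightarrow> exp 1) (at_right 0)"
  proof (rule real_tendsto_sandwich[where f = "\<lambda>_. exp 1"])
    show "((\<lambda>p::real. exp 1 + (exp 1 + 1) / \<bar>ln p\<bar>) \<longlongrightarrow> exp 1) (at_right 0)" by real_asymp
    show "eventually (\<lambda>p. exp 1 \<le> g p) (at_right 0)"
      using ev by eventually_elim (use g in auto)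
    show "eventually (\<lambda>p. g p \<le> exp 1 + (exp 1 + 1) / \<bar>ln p\<bar>) (at_right 0)"
      using ev by eventually_elim (use g in auto)
  qed auto
  moreover have "\<forall>\<^sub>F p in at_right 0. (\<lambda>N. avg_cost N p) \<longlonglongrightarrow> g p"
    using ev by eventually_elim (use g in auto)
  ultimately show "\<exists>g. (\<forall>\<^sub>F p in at_right 0. (\<lambda>N. avg_cost N p) \<longlonglongrightarrow> g p) \<and> (g \<longlongrightarrow> exp 1) (at_right 0)"
    by blast
qed

end
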